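(* Let $\Omega$ be an arbitrary index set. Suppose $L : A_{\Omega} \rightarrow \mathbb{R}$ is linear and $L(\operatorname{Pos}_{A_{\Omega}}(Y)) \subseteq [0,\infty)$, where $Y$ is a closed subset of $\mathbb{R}^{\Omega}$ satisfying either of the following equivalent conditions: (i) there exists a countable subset $S$ of $A_{\Omega}$ such that $Y = \{ \alpha \in \mathbb{R}^{\Omega} \mid \hat{g}(\alpha)\ge 0 \ \forall\, g\in S\}$; (ii) there exist a countable subset $I \subseteq \Omega$ and a closed subset $Y'$ of $\mathbb{R}^I$ such that $Y = \pi^{-1}(Y')$, where $\pi : \mathbb{R}^{\Omega} \rightarrow \mathbb{R}^I$ is the projection. Then there exists a constructibly Radon measure $\nu$ on $\mathbb{R}^{\Omega}$ (with finite moments) supported by $Y$ such that $L = L_{\nu}$, i.e. $L(f)=\int\hat f\,d\nu$ for all $f\in A_\Omega$.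
   Context: $A_\Omega=\mathbb{R}[x_i\mid i\in\Omega]$; for $f\in A_\Omega$, $\hat f:\mathbb{R}^\Omega\to\mathbb{R}$ is the evaluation function. $\operatorname{Pos}_{A_\Omega}(Y)=\{f\in A_\Omega\mid \hat f\ge0\text{ on }Y\}$. $\mathbb{R}^\Omega$ has the product topology. For a commutative $\mathbb{R}$-algebra $D$ with $1$, $X(D)$ is the set of unital ring homomorphisms $\alpha:D\to\mathbb{R}$ with the weakest topology making all $\hat a:\alpha\mapsto\alpha(a)$, $a\in D$, continuous. A subset of $X(D)$ is constructibly Borel if it lies in the $\sigma$-algebra generated by the sets $\{\alpha\in X(D)\mid\alpha(a)>0\}$, $a\in D$. A Radon measure is a positive, locally finite, inner regular (with respect to compact sets) measure on the Borel $\sigma$-algebra. A constructibly Radon measure on $X(D)$ is a positive measure on the $\sigma$-algebra of constructibly Borel sets such that, for each countably generated subalgebra $D'$ of $D$, its pushforward to $X(D')$ via $\alpha\mapsto\alpha|_{D'}$ is Radon. $\mathbb{R}^\Omega$ is identified with $X(A_\Omega)$ via point evaluations. By convention, a constructibly Radon measure $\nu$ on $\mathbb{R}^\Omega$ is required to have finite moments: $\int \hat f\,d\nu$ is well-defined and finite for every monomial $f$ in the $x_i$. For such $\nu$, $L_\nu(f)=\int\hat f\,d\nu$ for $f\in A_\Omega$. A measure $\nu$ on $(X,\Sigma)$ is supported by $Y\subseteq X$ if $\nu(E)=0$ for every $E\in\Sigma$ with $E\cap Y=\emptyset$. *)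

theory Defs
  imports "HOL-Analysis.Analysis" "HOL-Library.Poly_Mapping"
begin

section \<open>Finitely supported functions as a real algebra\<close>

instantiation poly_mapping :: (type, real_vector) real_vector
begin

lift_definition scaleR_poly_mapping :: "real \<Rightarrow> ('a \<Rightarrow>\<^sub>0 'b) \<Rightarrow> ('a \<Rightarrow>\<^sub>0 'b)"
  is "\<lambda>c f k. c *\<^sub>R f k"
  by (erule rev_finite_subset) auto

instance
  by standard (transfer; simp add: fun_eq_iff scaleR_add_right scaleR_add_left)+

end

lemma scaleR_eq_single_times:
  fixes f :: "'a::monoid_add \<Rightarrow>\<^sub>0 'b::real_algebra_1"
  shows "c *\<^sub>R f = Poly_Mapping.single 0 (of_real c) * f"
proof (rule poly_mapping_eqI)
  fix k
  have "Poly_Mapping.lookup (Poly_Mapping.single 0 (of_real c) * f) k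
      = Poly_Mapping.lookup (Poly_Mapping.map ((*) (of_real c)) f) k"
    by (simp add: mult_map_scale_conv_mult)
  also have "\<dots> = c *\<^sub>R Poly_Mapping.lookup f k"
    by (simp add: Poly_Mapping.map.rep_eq when_def scaleR_conv_of_real)
  finally show "Poly_Mapping.lookup (c *\<^sub>R f) k = Poly_Mapping.lookup (Poly_Mapping.single 0 (of_real c) * f) k"
    by (simp add: scaleR_poly_mapping.rep_eq)
qed

instance poly_mapping :: (comm_monoid_add, "{comm_ring_1, real_algebra_1}") real_algebra_1
proof
  fix c :: real and f g :: "'a \<Rightarrow>\<^sub>0 'b"
  show "c *\<^sub>R f * g = c *\<^sub>R (f * g)"
    by (simp add: scaleR_eq_single_times mult.assoc)
  show "f * c *\<^sub>R g = c *\<^sub>R (f * g)"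
    by (simp add: scaleR_eq_single_times mult.left_commute)
qed


section \<open>Subalgebras and character spaces\<close>

text \<open>Algebras are subalgebras (always containing the unit) of an ambient algebra type, so that
  an algebra and its subalgebras can be discussed together.\<close>

definition subalgebra :: "'a::real_algebra_1 set \<Rightarrow> bool" where
  "subalgebra D \<longleftrightarrow> subspace D \<and> 1 \<in> D \<and> (\<forall>a\<in>D. \<forall>b\<in>D. a * b \<in> D)"

definition countably_generated_subalgebra :: "'a::real_algebra_1 set \<Rightarrow> bool" where
  "countably_generated_subalgebra D \<longleftrightarrow> (\<exists>C. countable C \<and> D = subalgebra hull C)"

definition char_space :: "'a::{comm_ring_1, real_algebra_1} set \<Rightarrow> ('a \<Rightarrow> real) set" where
  "char_space D = {\<alpha> \<in> extensional D. \<alpha> 1 = 1 \<and>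
     (\<forall>a\<in>D. \<forall>b\<in>D. \<alpha> (a + b) = \<alpha> a + \<alpha> b \<and> \<alpha> (a * b) = \<alpha> a * \<alpha> b)}"

definition char_topology :: "'a::{comm_ring_1, real_algebra_1} set \<Rightarrow> ('a \<Rightarrow> real) topology" where
  "char_topology D =
     topology_generated_by {{\<alpha> \<in> char_space D. \<alpha> a \<in> U} | a U. a \<in> D \<and> open U}"

definition constr_borel :: "'a::{comm_ring_1, real_algebra_1} set \<Rightarrow> ('a \<Rightarrow> real) measure" where
  "constr_borel D = sigma (char_space D) {{\<alpha> \<in> char_space D. \<alpha> a > 0} | a. a \<in> D}"


section \<open>Radon and constructibly Radon measures\<close>

definition borel_of_topology :: "'a topology \<Rightarrow> 'a measure" where
  "borel_of_topology T = sigma (topspace T) {U. openin T U}"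

text \<open>Used only for Hausdorff spaces, where compact sets are Borel.\<close>

definition radon_measure :: "'a topology \<Rightarrow> 'a measure \<Rightarrow> bool" where
  "radon_measure T \<mu> \<longleftrightarrow>
     sets \<mu> = sets (borel_of_topology T) \<and>
     (\<forall>x\<in>topspace T. \<exists>U. openin T U \<and> x \<in> U \<and> emeasure \<mu> U < \<infinity>) \<and>
     (\<forall>E\<in>sets \<mu>. emeasure \<mu> E = (SUP K\<in>{K. compactin T K \<and> K \<subseteq> E}. emeasure \<mu> K))"

text \<open>The measurability clause states that the pushforward is well defined; without it,
  \<^const>\<open>distr\<close> could degenerate to the zero measure.\<close>

definition constr_radon :: "'a::{comm_ring_1, real_algebra_1} set \<Rightarrow> ('a \<Rightarrow> real) measure \<Rightarrow> bool" where
  "constr_radon D \<mu> \<longleftrightarrow>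
     sets \<mu> = sets (constr_borel D) \<and>
     (\<forall>D'. D' \<subseteq> D \<and> countably_generated_subalgebra D' \<longrightarrow>
        (\<lambda>\<alpha>. restrict \<alpha> D') \<in> measurable \<mu> (borel_of_topology (char_topology D')) \<and>
        radon_measure (char_topology D')
          (distr \<mu> (borel_of_topology (char_topology D')) (\<lambda>\<alpha>. restrict \<alpha> D')))"

definition supported_by :: "'a measure \<Rightarrow> 'a set \<Rightarrow> bool" where
  "supported_by \<nu> Y \<longleftrightarrow> (\<forall>E\<in>sets \<nu>. E \<inter> Y = {} \<longrightarrow> emeasure \<nu> E = 0)"


section \<open>The polynomial algebra over an arbitrary index set\<close>

text \<open>A polynomial maps an exponent vector to its coefficient. The index set is an arbitrary,
  possibly empty, subset of a type.\<close>

type_synonym 'i mpolynomial = "('i \<Rightarrow>\<^sub>0 nat) \<Rightarrow>\<^sub>0 real"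

definition poly_alg :: "'i set \<Rightarrow> 'i mpolynomial set" where
  "poly_alg \<Omega> = {f. \<forall>m\<in>Poly_Mapping.keys f. Poly_Mapping.keys m \<subseteq> \<Omega>}"

definition peval :: "'i mpolynomial \<Rightarrow> ('i \<Rightarrow> real) \<Rightarrow> real" where
  "peval f x = (\<Sum>m\<in>Poly_Mapping.keys f. Poly_Mapping.lookup f m * (\<Prod>i\<in>Poly_Mapping.keys m. x i ^ Poly_Mapping.lookup m i))"

abbreviation real_power :: "'i set \<Rightarrow> ('i \<Rightarrow> real) topology" where
  "real_power \<Omega> \<equiv> product_topology (\<lambda>_. euclideanreal) \<Omega>"

definition Pos :: "'i set \<Rightarrow> ('i \<Rightarrow> real) set \<Rightarrow> 'i mpolynomial set" where
  "Pos \<Omega> Y = {f \<in> poly_alg \<Omega>. \<forall>x\<in>Y. 0 \<le> peval f x}"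

definition point_eval :: "'i set \<Rightarrow> ('i \<Rightarrow> real) \<Rightarrow> ('i mpolynomial \<Rightarrow> real)" where
  "point_eval \<Omega> x = (\<lambda>f\<in>poly_alg \<Omega>. peval f x)"

text \<open>The measurable sets and the constructibly Radon property are transported from the character
  space of the polynomial algebra along point evaluations. The last clause is the convention that
  all moments are finite.\<close>

definition constr_radon_power :: "'i set \<Rightarrow> ('i \<Rightarrow> real) measure \<Rightarrow> bool" where
  "constr_radon_power \<Omega> \<nu> \<longleftrightarrow>
     space \<nu> = topspace (real_power \<Omega>) \<and>
     sets \<nu> = sets (vimage_algebra (topspace (real_power \<Omega>)) (point_eval \<Omega>)
                       (constr_borel (poly_alg \<Omega>))) \<and>
     constr_radon (poly_alg \<Omega>) (distr \<nu> (constr_borel (poly_alg \<Omega>)) (point_eval \<Omega>)) \<and>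
     (\<forall>m. Poly_Mapping.keys m \<subseteq> \<Omega> \<longrightarrow> integrable \<nu> (peval (Poly_Mapping.single m 1)))"

definition countably_presented :: "'i set \<Rightarrow> ('i \<Rightarrow> real) set \<Rightarrow> bool" where
  "countably_presented \<Omega> Y \<longleftrightarrow>
     (\<exists>S. S \<subseteq> poly_alg \<Omega> \<and> countable S \<and>
        Y = {\<alpha> \<in> topspace (real_power \<Omega>). \<forall>g\<in>S. 0 \<le> peval g \<alpha>})"

definition countable_cylinder :: "'i set \<Rightarrow> ('i \<Rightarrow> real) set \<Rightarrow> bool" where
  "countable_cylinder \<Omega> Y \<longleftrightarrow>
     (\<exists>I Y'. I \<subseteq> \<Omega> \<and> countable I \<and> closedin (real_power I) Y' \<and>
        Y = {\<alpha> \<in> topspace (real_power \<Omega>). restrict \<alpha> I \<in> Y'})"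

end

theory Submission
  imports Defs "HOL-Library.Function_Algebras"
begin

text \<open>
  By the Hahn-Banach theorem L extends to a linear functional on all polynomially bounded functions
  that is still nonnegative on functions nonnegative on Y. Code a point of the power of the real line
  by the signs and binary digits of its coordinates. The extended functional, applied to indicators of
  sets determined by finitely many digits, is a finitely additive measure on the clopen algebra of a
  Cantor cube, hence by compactness a premeasure, and Caratheodory's theorem applies. The truncated
  binary expansions converge almost everywhere and monotonically in absolute value, dominated by
  monomials of finite integral, so dominated convergence recovers the functional at f and at the
  negative part of f, for every polynomial f. The first gives L as integration, the second that every
  polynomial inequality valid on Y holds almost everywhere; countably many of them cut out Y.

  The constructibly Radon property holds for every finite measure, because the character space of a
  countably generated algebra is a closed subspace of a countable power of the real line, where finite
  Borel measures are inner regular.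
\<close>

section \<open>Polynomial evaluation\<close>

text \<open>Representing measures need not be unique in finitely many variables, so separate choices
  for each finite set of coordinates need not form a projective system. A single extended functional
  makes all these choices coherently. The price is that it is only finitely additive, so countable
  limits may not be taken inside it. Every limit on its side is therefore controlled by a rate: a
  polynomial at the truncated point differs from its value at the point by at most
  \<open>H x / 2 ^ n\<close> with \<open>H\<close> polynomially bounded, and positivity alone
  handles such an error.

  The other danger is mass escaping to infinity, since the measure on codes might a priori charge
  divergent digit sequences. The finite value of the functional at \<open>\<bar>x i\<bar>\<close>
  excludes this almost everywhere, one coordinate at a time. Over an uncountable index set the
  exceptional null sets cannot be united, so each argument is confined to countably many of
  them.\<close>

definition mon :: "('i \<Rightarrow>\<^sub>0 nat) \<Rightarrow> ('i \<Rightarrow> real) \<Rightarrow> real" where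
  "mon m x = (\<Prod>i\<in>Poly_Mapping.keys m. x i ^ Poly_Mapping.lookup m i)"

text \<open>Monomials with different supports are combined after letting both products range over a
  common finite set; the added factors are zeroth powers.\<close>

lemma mon_superset:
  assumes "finite F" "Poly_Mapping.keys m \<subseteq> F"
  shows "mon m x = (\<Prod>i\<in>F. x i ^ Poly_Mapping.lookup m i)"
  unfolding mon_def using assms
  by (intro prod.mono_neutral_left) (auto simp: in_keys_iff)

lemma mon_zero [simp]: "mon 0 x = 1"
  by (simp add: mon_def)

lemma mon_add: "mon (m + m') x = mon m x * mon m' x"
proof -
  let ?F = "Poly_Mapping.keys m \<union> Poly_Mapping.keys m'"
  have "mon (m + m') x = (\<Prod>i\<in>?F. x i ^ Poly_Mapping.lookup (m + m') i)"
    using keys_add[of m m'] by (intro mon_superset) auto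
  also have "\<dots> = mon m x * mon m' x"
    by (subst (1 2) mon_superset[of ?F]) (auto simp: lookup_add power_add prod.distrib)
  finally show ?thesis .
qed

lemma mon_mono:
  assumes "\<And>i. i \<in> Poly_Mapping.keys m \<Longrightarrow> \<bar>x i\<bar> \<le> \<bar>y i\<bar>"
  shows "\<bar>mon m x\<bar> \<le> \<bar>mon m y\<bar>"
  unfolding mon_def abs_prod power_abs
  using assms by (intro prod_mono conjI power_mono) auto

lemma peval_mon: "peval f x = (\<Sum>m\<in>Poly_Mapping.keys f. Poly_Mapping.lookup f m * mon m x)"
  by (simp add: peval_def mon_def)

lemma peval_superset:
  assumes "finite F" "Poly_Mapping.keys f \<subseteq> F"
  shows "peval f x = (\<Sum>m\<in>F. Poly_Mapping.lookup f m * mon m x)"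
  unfolding peval_mon using assms
  by (intro sum.mono_neutral_left) (auto simp: in_keys_iff)

lemma peval_add: "peval (f + g) x = peval f x + peval g x"
proof -
  let ?F = "Poly_Mapping.keys f \<union> Poly_Mapping.keys g"
  have "peval (f + g) x = (\<Sum>m\<in>?F. Poly_Mapping.lookup (f + g) m * mon m x)"
    using keys_add[of f g] by (intro peval_superset) auto
  also have "\<dots> = peval f x + peval g x"
    by (subst (1 2) peval_superset[of ?F]) (auto simp: lookup_add algebra_simps sum.distrib)
  finally show ?thesis .
qed

lemma peval_zero [simp]: "peval 0 x = 0"
  by (simp add: peval_def)

lemma peval_single: "peval (Poly_Mapping.single m c) x = c * mon m x"
  by (simp add: peval_mon)

lemma peval_one [simp]: "peval 1 x = 1"
  using peval_single[of 0 1 x] by simp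

lemma peval_sum: "peval (\<Sum>a\<in>A. f a) x = (\<Sum>a\<in>A. peval (f a) x)"
  by (induction A rule: infinite_finite_induct) (auto simp: peval_add)

lemma poly_mapping_sum_single:
  "f = (\<Sum>m\<in>Poly_Mapping.keys f. Poly_Mapping.single m (Poly_Mapping.lookup f m))"
  by (rule poly_mapping_eqI)
    (auto simp: lookup_sum lookup_single when_def in_keys_iff)

lemma peval_mult: "peval (f * g) x = peval f x * peval g x"
proof -
  have "f * g = (\<Sum>m\<in>Poly_Mapping.keys f. \<Sum>n\<in>Poly_Mapping.keys g.
      Poly_Mapping.single (m + n) (Poly_Mapping.lookup f m * Poly_Mapping.lookup g n))"
    by (subst (1) poly_mapping_sum_single[of f], subst (1) poly_mapping_sum_single[of g])
      (simp add: sum_product mult_single)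
  then have "peval (f * g) x = (\<Sum>m\<in>Poly_Mapping.keys f. \<Sum>n\<in>Poly_Mapping.keys g.
      (Poly_Mapping.lookup f m * mon m x) * (Poly_Mapping.lookup g n * mon n x))"
    by (simp add: peval_sum peval_single mon_add mult_ac)
  then show ?thesis
    by (simp add: peval_mon sum_product)
qed

lemma peval_scaleR: "peval (c *\<^sub>R f) x = c * peval f x"
  by (simp add: scaleR_eq_single_times peval_mult peval_single)

lemma peval_uminus: "peval (- f) x = - peval f x"
  using peval_scaleR[of "-1" f x] by simp

lemma peval_diff: "peval (f - g) x = peval f x - peval g x"
  using peval_add[of f "- g" x] by (simp add: peval_uminus)

definition pvar :: "'i \<Rightarrow> 'i mpolynomial" where
  "pvar i = Poly_Mapping.single (Poly_Mapping.single i 1) 1"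

lemma peval_pvar [simp]: "peval (pvar i) x = x i"
  by (simp add: pvar_def peval_single mon_def)

text \<open>\<open>peval\<close> accepts arbitrary functions on the index type, whereas points of
  the power are extensional. This permits passing between a point and its restriction.\<close>

lemma peval_cong:
  assumes "f \<in> poly_alg \<Omega>" "\<And>i. i \<in> \<Omega> \<Longrightarrow> x i = y i"
  shows "peval f x = peval f y"
  unfolding peval_def using assms
  by (intro sum.cong prod.cong refl arg_cong2[of _ _ _ _ times])
    (metis (mono_tags, lifting) mem_Collect_eq poly_alg_def subsetD)

section \<open>Closure properties of the polynomial algebra\<close>

lemma single_in_poly_alg: "Poly_Mapping.keys m \<subseteq> \<Omega> \<Longrightarrow> Poly_Mapping.single m c \<in> poly_alg \<Omega>"
  by (auto simp: poly_alg_def split: if_splits)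

lemma pvar_in_poly_alg: "i \<in> \<Omega> \<Longrightarrow> pvar i \<in> poly_alg \<Omega>"
  by (simp add: pvar_def single_in_poly_alg)

lemma zero_in_poly_alg: "0 \<in> poly_alg \<Omega>"
  by (simp add: poly_alg_def)

lemma one_in_poly_alg: "1 \<in> poly_alg \<Omega>"
  by (simp add: poly_alg_def)

lemma add_in_poly_alg: "f \<in> poly_alg \<Omega> \<Longrightarrow> g \<in> poly_alg \<Omega> \<Longrightarrow> f + g \<in> poly_alg \<Omega>"
  using keys_add[of f g] by (auto simp: poly_alg_def)

lemma mult_in_poly_alg:
  assumes "f \<in> poly_alg \<Omega>" "g \<in> poly_alg \<Omega>"
  shows "f * g \<in> poly_alg \<Omega>"
  unfolding poly_alg_def
proof safe
  fix m i assume "m \<in> Poly_Mapping.keys (f * g)" and i: "i \<in> Poly_Mapping.keys m"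
  then obtain a b where ab: "a \<in> Poly_Mapping.keys f" "b \<in> Poly_Mapping.keys g" "m = a + b"
    using keys_mult[of f g] by auto
  then show "i \<in> \<Omega>"
    using i keys_add[of a b] assms by (auto simp: poly_alg_def)
qed

lemma scaleR_in_poly_alg: "f \<in> poly_alg \<Omega> \<Longrightarrow> c *\<^sub>R f \<in> poly_alg \<Omega>"
  unfolding scaleR_eq_single_times by (intro mult_in_poly_alg single_in_poly_alg) auto

lemma uminus_in_poly_alg: "f \<in> poly_alg \<Omega> \<Longrightarrow> - f \<in> poly_alg \<Omega>"
  using scaleR_in_poly_alg[of f \<Omega> "-1"] by simp

lemma diff_in_poly_alg: "f \<in> poly_alg \<Omega> \<Longrightarrow> g \<in> poly_alg \<Omega> \<Longrightarrow> f - g \<in> poly_alg \<Omega>"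
  using add_in_poly_alg[of f \<Omega> "- g"] by (simp add: uminus_in_poly_alg)

section \<open>Extension of positive functionals\<close>

instantiation "fun" :: (type, real_vector) real_vector
begin

definition scaleR_fun :: "real \<Rightarrow> ('a \<Rightarrow> 'b) \<Rightarrow> 'a \<Rightarrow> 'b" where
  "scaleR_fun c f = (\<lambda>x. c *\<^sub>R f x)"

instance
  by standard (simp_all add: scaleR_fun_def fun_eq_iff algebra_simps)

end

lemma scaleR_fun_apply [simp]: "(c *\<^sub>R f) x = c *\<^sub>R f x" for f :: "'a \<Rightarrow> 'b::real_vector"
  by (simp add: scaleR_fun_def)

section \<open>Minimal sublinear functionals and the Hahn-Banach theorem\<close>

definition sublinear_on :: "'v::real_vector set \<Rightarrow> ('v \<Rightarrow> real) \<Rightarrow> bool" where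
  "sublinear_on W q \<longleftrightarrow>
     (\<forall>x\<in>W. \<forall>y\<in>W. q (x + y) \<le> q x + q y) \<and> (\<forall>c>0. \<forall>x\<in>W. q (c *\<^sub>R x) \<le> c * q x)"

lemma sublinear_on_zero:
  assumes "sublinear_on W q" "subspace W"
  shows "q 0 = 0"
proof -
  have 0: "0 \<in> W" using assms(2) by (rule subspace_0)
  \<comment> \<open>Doubling gives q 0 \<ge> 0 and halving gives q 0 \<le> 0.\<close>
  have "q (2 *\<^sub>R 0) \<le> 2 * q 0" "q ((1/2) *\<^sub>R 0) \<le> (1/2) * q 0"
    using assms(1) 0 unfolding sublinear_on_def by (metis zero_less_numeral, metis half_gt_zero zero_less_one)
  then show ?thesis by simp
qed

text \<open>The one-sided inequality, used with c and with 1/c, gives equality. The definition keeps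
  the weaker form because it is what an infimum satisfies directly.\<close>

lemma sublinear_on_scaleR:
  assumes "sublinear_on W q" "subspace W" "c > 0" "x \<in> W"
  shows "q (c *\<^sub>R x) = c * q x"
proof (rule antisym)
  show "q (c *\<^sub>R x) \<le> c * q x"
    using assms unfolding sublinear_on_def by blast
  have "q ((1/c) *\<^sub>R (c *\<^sub>R x)) \<le> (1/c) * q (c *\<^sub>R x)"
    using assms unfolding sublinear_on_def by (meson subspace_scale zero_less_divide_1_iff)
  then show "c * q x \<le> q (c *\<^sub>R x)"
    using assms(3) by (simp add: field_simps)
qed

lemma sublinear_on_lower:
  assumes "sublinear_on W q" "subspace W" "x \<in> W"
  shows "- q (- x) \<le> q x"
proof -
  have "q (x + - x) \<le> q x + q (- x)"
    using assms unfolding sublinear_on_def by (meson subspace_neg)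
  then show ?thesis using sublinear_on_zero[OF assms(1,2)] by simp
qed

lemma exists_minimal_sublinear:
  assumes W: "subspace W" and p: "sublinear_on W p"
  obtains q where "sublinear_on W q" "\<And>x. x \<in> W \<Longrightarrow> q x \<le> p x"
    "\<And>r. sublinear_on W r \<Longrightarrow> (\<And>x. x \<in> W \<Longrightarrow> r x \<le> q x) \<Longrightarrow> (\<And>x. x \<in> W \<Longrightarrow> r x = q x)"
proof -
  \<comment> \<open>Sublinearity says nothing about values off \<open>W\<close>. Pinning them to 0
    makes infima exist there and keeps them from obstructing minimality. The order \<open>P\<close>
    is reversed, so that Zorn's maximal elements are minimal functionals.\<close>
  define A where "A = {q. sublinear_on W q \<and> (\<forall>x\<in>W. q x \<le> p x) \<and> (\<forall>x. x \<notin> W \<longrightarrow> q x = 0)}"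
  define P where "P = (\<lambda>q r :: 'a \<Rightarrow> real. r \<le> q)"
  have restr: "sublinear_on W (\<lambda>x. if x \<in> W then r x else 0)" if "sublinear_on W r" for r
    using that W unfolding sublinear_on_def by (auto simp: subspace_add subspace_scale)
  have "\<exists>m\<in>A. \<forall>a\<in>A. P m a \<longrightarrow> a = m"
  proof (rule predicate_Zorn)
    show "partial_order_on A (relation_of P A)"
      unfolding P_def
      by (auto simp: partial_order_on_def preorder_on_def refl_on_def trans_def antisym_def relation_of_def)
    fix C assume C: "C \<in> Chains (relation_of P A)"
    have CA: "q \<in> A" if "q \<in> C" for q
      using C that by (auto simp: Chains_def relation_of_def)
    have chain: "q \<le> r \<or> r \<le> q" if "q \<in> C" "r \<in> C" for q r
      using C that by (auto simp: Chains_def relation_of_def P_def)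
    show "\<exists>u\<in>A. \<forall>a\<in>C. P a u"
    proof (cases "C = {}")
      case True
      then show ?thesis
        using restr[OF p] by (intro bexI[of _ "\<lambda>x. if x \<in> W then p x else 0"]) (auto simp: A_def)
    next
      case False
      define u where "u = (\<lambda>x. INF q\<in>C. q x)"
      have bdd: "bdd_below ((\<lambda>q. q x) ` C)" for x
      proof (cases "x \<in> W")
        case True
        \<comment> \<open>All members lie below p, which bounds them below as well, at - p (- x);
          the infimum of the chain is therefore finite.\<close>
        have "- p (- x) \<le> q x" if "q \<in> C" for q
        proof -
          have "q \<in> A" using CA that .
          then have "- q (- x) \<le> q x" "q (- x) \<le> p (- x)"
            using True W by (auto simp: A_def subspace_neg intro: sublinear_on_lower)
          then show ?thesis by linarith
        qed
        then show ?thesis by (intro bdd_belowI2)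
      next
        case False
        then have "0 \<le> q x" if "q \<in> C" for q using CA[OF that] by (simp add: A_def)
        then show ?thesis by (intro bdd_belowI2)
      qed
      have le: "u x \<le> q x" if "q \<in> C" for q x
        unfolding u_def using bdd that by (intro cINF_lower)
      have ge: "b \<le> u x" if "\<And>q. q \<in> C \<Longrightarrow> b \<le> q x" for b x
        unfolding u_def using False that by (intro cINF_greatest)
      have "sublinear_on W u"
        unfolding sublinear_on_def
      proof (intro conjI ballI allI impI)
        fix x y assume xy: "x \<in> W" "y \<in> W"
        have *: "u (x + y) \<le> q x + r y" if qr: "q \<in> C" "r \<in> C" for q r
        proof -
          \<comment> \<open>The infima at x and at y may be approached along different members; the
            chain property replaces both by the smaller one.\<close>
          obtain s where s: "s \<in> C" "s \<le> q" "s \<le> r" using chain[OF qr] qr by auto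
          have "u (x + y) \<le> s (x + y)" using s le by blast
          also have "\<dots> \<le> s x + s y"
            using CA[OF s(1)] xy by (auto simp: A_def sublinear_on_def)
          also have "\<dots> \<le> q x + r y" using s by (auto simp: le_fun_def intro: add_mono)
          finally show ?thesis .
        qed
        have "u (x + y) - u y \<le> u x"
        proof (rule ge)
          fix q assume q: "q \<in> C"
          have "u (x + y) - q x \<le> u y"
            by (rule ge) (use *[OF q] in \<open>simp add: algebra_simps\<close>)
          then show "u (x + y) - u y \<le> q x" by linarith
        qed
        then show "u (x + y) \<le> u x + u y" by linarith
      next
        fix c :: real and x assume c: "c > 0" and x: "x \<in> W"
        have "u (c *\<^sub>R x) / c \<le> u x"
        proof (rule ge)
          fix q assume q: "q \<in> C"
          have "u (c *\<^sub>R x) \<le> q (c *\<^sub>R x)" using le q .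
          also have "\<dots> \<le> c * q x" using CA[OF q] c x by (auto simp: A_def sublinear_on_def)
          finally show "u (c *\<^sub>R x) / c \<le> q x" using c by (simp add: field_simps)
        qed
        then show "u (c *\<^sub>R x) \<le> c * u x" using c by (simp add: field_simps)
      qed
      moreover have "u x \<le> p x" if "x \<in> W" for x
      proof -
        obtain q where "q \<in> C" using False by auto
        then show ?thesis using le[of q x] CA[of q] that by (auto simp: A_def intro: order_trans)
      qed
      moreover have "u x = 0" if "x \<notin> W" for x
      proof -
        have "(\<lambda>q. q x) ` C = (\<lambda>_. 0) ` C"
        proof (rule image_cong[OF refl])
          fix q assume "q \<in> C"
          from CA[OF this] show "q x = 0" using that by (simp add: A_def)
        qed
        then show ?thesis using False by (simp add: u_def)
      qed
      ultimately have "u \<in> A" by (simp add: A_def)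
      then show ?thesis using le by (auto simp: P_def le_fun_def)
    qed
  qed
  then obtain q where q: "q \<in> A" and min: "\<And>r. r \<in> A \<Longrightarrow> r \<le> q \<Longrightarrow> r = q"
    by (auto simp: P_def)
  show ?thesis
  proof
    show "sublinear_on W q" "\<And>x. x \<in> W \<Longrightarrow> q x \<le> p x" using q by (auto simp: A_def)
    fix r x assume r: "sublinear_on W r" "\<And>x. x \<in> W \<Longrightarrow> r x \<le> q x" and x: "x \<in> W"
    let ?r = "\<lambda>x. if x \<in> W then r x else 0"
    have "?r = q"
    proof (rule min)
      show "?r \<in> A" using restr[OF r(1)] r(2) q by (force simp: A_def)
      show "?r \<le> q" using r(2) q by (auto simp: le_fun_def A_def)
    qed
    then show "r x = q x" using x fun_cong[of ?r q x] by simp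
  qed
qed

text \<open>A minimal sublinear functional q is linear: for fixed y the functional
  x \<mapsto> inf over t \<ge> 0 of q (x + t y) - t q y is again sublinear and lies below q, hence equals q;
  taking t = 1 yields superadditivity of q.\<close>

lemma hahn_banach_dominated:
  assumes W: "subspace W" and p: "sublinear_on W p"
  obtains \<Lambda> where "\<And>x y. x \<in> W \<Longrightarrow> y \<in> W \<Longrightarrow> \<Lambda> (x + y) = \<Lambda> x + \<Lambda> y"
    "\<And>c x. x \<in> W \<Longrightarrow> \<Lambda> (c *\<^sub>R x) = c * \<Lambda> x" "\<And>x. x \<in> W \<Longrightarrow> \<Lambda> x \<le> p x"
proof -
  obtain q where q: "sublinear_on W q" and qp: "\<And>x. x \<in> W \<Longrightarrow> q x \<le> p x" and
    min: "\<And>r x. sublinear_on W r \<Longrightarrow> (\<And>x. x \<in> W \<Longrightarrow> r x \<le> q x) \<Longrightarrow> x \<in> W \<Longrightarrow> r x = q x"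
    using exists_minimal_sublinear[OF W p] by metis
  have sub: "q (x + y) \<le> q x + q y" if "x \<in> W" "y \<in> W" for x y
    using q that by (simp add: sublinear_on_def)
  have scale0: "q (c *\<^sub>R x) = c * q x" if "c \<ge> 0" "x \<in> W" for c x
    using sublinear_on_scaleR[OF q W, of c x] sublinear_on_zero[OF q W] that
    by (cases "c = 0") auto
  have super: "q x + q y \<le> q (x + y)" if x: "x \<in> W" and y: "y \<in> W" for x y
  proof -
    define r where "r = (\<lambda>x. INF t\<in>{0..}. q (x + t *\<^sub>R y) - t * q y)"
    have inW: "x + t *\<^sub>R y \<in> W" if "x \<in> W" for x t
      using that y W by (simp add: subspace_add subspace_scale)
    have bdd: "bdd_below ((\<lambda>t. q (x + t *\<^sub>R y) - t * q y) ` {0..})" if x: "x \<in> W" for x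
    proof (rule bdd_belowI2)
      fix t :: real assume t: "t \<in> {0..}"
      \<comment> \<open>Writing t y as (x + t y) - x bounds the family below independently of
        t.\<close>
      have "q ((x + t *\<^sub>R y) + - x) \<le> q (x + t *\<^sub>R y) + q (- x)"
        using x inW W by (intro sub) (auto simp: subspace_neg)
      then show "- q (- x) \<le> q (x + t *\<^sub>R y) - t * q y" using t y scale0[of t y] by simp
    qed
    have le: "r x \<le> q (x + t *\<^sub>R y) - t * q y" if "x \<in> W" "t \<ge> 0" for x t
      unfolding r_def using bdd that by (intro cINF_lower) auto
    have ge: "b \<le> r x" if "\<And>t. t \<ge> 0 \<Longrightarrow> b \<le> q (x + t *\<^sub>R y) - t * q y" for b x
      unfolding r_def using that by (intro cINF_greatest) auto
    have "sublinear_on W r"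
      unfolding sublinear_on_def
    proof (intro conjI ballI allI impI)
      fix x z assume xz: "x \<in> W" "z \<in> W"
      have *: "r (x + z) \<le> (q (x + t *\<^sub>R y) - t * q y) + (q (z + s *\<^sub>R y) - s * q y)"
        if "t \<ge> 0" "s \<ge> 0" for t s
      proof -
        have "r (x + z) \<le> q ((x + z) + (t + s) *\<^sub>R y) - (t + s) * q y"
          using that xz W by (intro le) (auto simp: subspace_add)
        moreover have "(x + z) + (t + s) *\<^sub>R y = (x + t *\<^sub>R y) + (z + s *\<^sub>R y)"
          by (simp add: algebra_simps)
        ultimately show ?thesis
          using sub[OF inW[OF xz(1), of t] inW[OF xz(2), of s]] by (simp add: algebra_simps)
      qed
      have "r (x + z) - r z \<le> r x"
      proof (rule ge)
        fix t :: real assume t: "t \<ge> 0"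
        have "r (x + z) - (q (x + t *\<^sub>R y) - t * q y) \<le> r z"
          by (rule ge) (use *[OF t] in \<open>simp add: algebra_simps\<close>)
        then show "r (x + z) - r z \<le> q (x + t *\<^sub>R y) - t * q y" by linarith
      qed
      then show "r (x + z) \<le> r x + r z" by linarith
    next
      fix c :: real and x assume c: "c > 0" and x: "x \<in> W"
      have "r (c *\<^sub>R x) / c \<le> r x"
      proof (rule ge)
        fix t :: real assume t: "t \<ge> 0"
        have "r (c *\<^sub>R x) \<le> q (c *\<^sub>R x + (c * t) *\<^sub>R y) - (c * t) * q y"
          using c t x W by (intro le) (auto simp: subspace_scale)
        also have "c *\<^sub>R x + (c * t) *\<^sub>R y = c *\<^sub>R (x + t *\<^sub>R y)" by (simp add: algebra_simps)
        also have "q \<dots> = c * q (x + t *\<^sub>R y)" using c x inW by (intro scale0) auto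
        finally show "r (c *\<^sub>R x) / c \<le> q (x + t *\<^sub>R y) - t * q y"
          using c by (simp add: field_simps)
      qed
      then show "r (c *\<^sub>R x) \<le> c * r x" using c by (simp add: field_simps)
    qed
    moreover have "r x \<le> q x" if "x \<in> W" for x using le[OF that, of 0] by simp
    ultimately have "r x = q x" using min x by blast
    then show ?thesis using le[OF x, of 1] by simp
  qed
  have add: "q (x + y) = q x + q y" if "x \<in> W" "y \<in> W" for x y
    using sub super that by (simp add: antisym)
  have neg: "q (- x) = - q x" if "x \<in> W" for x
    using add[of x "- x"] that W sublinear_on_zero[OF q W] by (simp add: subspace_neg)
  have "q (c *\<^sub>R x) = c * q x" if "x \<in> W" for c x
  proof (cases "c \<ge> 0")
    case False
    then show ?thesis
      using scale0[of "- c" "- x"] that W neg[of x] by (simp add: subspace_neg)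
  qed (use scale0 that in auto)
  then show ?thesis using that[of q] add qp by blast
qed

section \<open>Polynomially bounded functions\<close>

definition poly_bounded :: "'i set \<Rightarrow> (('i \<Rightarrow> real) \<Rightarrow> real) set" where
  "poly_bounded \<Omega> = {f. \<exists>g\<in>poly_alg \<Omega>. \<forall>x. \<bar>f x\<bar> \<le> peval g x}"

lemma poly_boundedI: "g \<in> poly_alg \<Omega> \<Longrightarrow> (\<And>x. \<bar>f x\<bar> \<le> peval g x) \<Longrightarrow> f \<in> poly_bounded \<Omega>"
  by (auto simp: poly_bounded_def)

lemma poly_bounded_mono: "f \<in> poly_bounded \<Omega> \<Longrightarrow> (\<And>x. \<bar>g x\<bar> \<le> \<bar>f x\<bar>) \<Longrightarrow> g \<in> poly_bounded \<Omega>"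
  by (auto simp: poly_bounded_def intro: order_trans)

text \<open>The absolute value of a polynomial is in general no polynomial; 2|t| \<le> 1 + t^2
  supplies the majorant 1 + f^2.\<close>

lemma peval_poly_bounded: "f \<in> poly_alg \<Omega> \<Longrightarrow> peval f \<in> poly_bounded \<Omega>"
proof (rule poly_boundedI)
  fix x
  have "0 \<le> (\<bar>peval f x\<bar> - 1)\<^sup>2" by simp
  then have "2 * \<bar>peval f x\<bar> \<le> 1 + (peval f x)\<^sup>2" by (simp add: power2_eq_square algebra_simps)
  moreover have "peval f x * peval f x = (peval f x)\<^sup>2" by (simp add: power2_eq_square)
  ultimately show "\<bar>peval f x\<bar> \<le> peval (1 + f * f) x"
    by (simp add: peval_add peval_mult)
qed (auto intro: add_in_poly_alg mult_in_poly_alg one_in_poly_alg)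

lemma poly_bounded_const: "(\<lambda>_. c) \<in> poly_bounded \<Omega>"
  by (rule poly_boundedI[of "\<bar>c\<bar> *\<^sub>R 1"])
    (auto simp: peval_scaleR intro: scaleR_in_poly_alg one_in_poly_alg)

lemma poly_bounded_add:
  assumes "f \<in> poly_bounded \<Omega>" "g \<in> poly_bounded \<Omega>"
  shows "(\<lambda>x. f x + g x) \<in> poly_bounded \<Omega>"
proof -
  obtain u v where uv: "u \<in> poly_alg \<Omega>" "v \<in> poly_alg \<Omega>" "\<And>x. \<bar>f x\<bar> \<le> peval u x" "\<And>x. \<bar>g x\<bar> \<le> peval v x"
    using assms by (auto simp: poly_bounded_def)
  have "\<bar>f x + g x\<bar> \<le> peval (u + v) x" for x
    using uv(3,4)[of x] unfolding peval_add by linarith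
  then show ?thesis using uv by (intro poly_boundedI[of "u + v"] add_in_poly_alg)
qed

lemma poly_bounded_mult:
  assumes "f \<in> poly_bounded \<Omega>" "g \<in> poly_bounded \<Omega>"
  shows "(\<lambda>x. f x * g x) \<in> poly_bounded \<Omega>"
proof -
  obtain u v where uv: "u \<in> poly_alg \<Omega>" "v \<in> poly_alg \<Omega>" "\<And>x. \<bar>f x\<bar> \<le> peval u x" "\<And>x. \<bar>g x\<bar> \<le> peval v x"
    using assms by (auto simp: poly_bounded_def)
  have "\<bar>f x * g x\<bar> \<le> peval (u * v) x" for x
    unfolding peval_mult abs_mult using uv(3,4)[of x] by (intro mult_mono) auto
  then show ?thesis using uv by (intro poly_boundedI[of "u * v"] mult_in_poly_alg)
qed

lemma poly_bounded_abs: "f \<in> poly_bounded \<Omega> \<Longrightarrow> (\<lambda>x. \<bar>f x\<bar>) \<in> poly_bounded \<Omega>"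
  by (erule poly_bounded_mono) simp

lemma subspace_poly_bounded: "subspace (poly_bounded \<Omega>)"
  unfolding subspace_def
proof (intro conjI ballI allI)
  show "0 \<in> poly_bounded \<Omega>"
    using poly_bounded_const[of 0 \<Omega>] by (simp add: zero_fun_def)
  show "f + g \<in> poly_bounded \<Omega>" if "f \<in> poly_bounded \<Omega>" "g \<in> poly_bounded \<Omega>" for f g
    using poly_bounded_add[OF that] by (simp add: plus_fun_def)
  show "c *\<^sub>R f \<in> poly_bounded \<Omega>" if "f \<in> poly_bounded \<Omega>" for c f
    using poly_bounded_mult[OF poly_bounded_const that, of c] by (simp add: scaleR_fun_def)
qed

text \<open>No measurability is asked of the functions, so indicators of arbitrary sets belong to
  the domain. Positivity is tested on \<open>Y\<close> only, hence values off \<open>Y\<close> do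
  not affect \<open>\<Lambda>\<close>, while membership in the domain is a bound at all
  points.\<close>

locale positive_functional =
  fixes \<Omega> :: "'i set" and Y :: "('i \<Rightarrow> real) set" and \<Lambda> :: "(('i \<Rightarrow> real) \<Rightarrow> real) \<Rightarrow> real"
  assumes add: "f \<in> poly_bounded \<Omega> \<Longrightarrow> g \<in> poly_bounded \<Omega> \<Longrightarrow> \<Lambda> (\<lambda>x. f x + g x) = \<Lambda> f + \<Lambda> g"
    and scale: "f \<in> poly_bounded \<Omega> \<Longrightarrow> \<Lambda> (\<lambda>x. c * f x) = c * \<Lambda> f"
    and pos: "f \<in> poly_bounded \<Omega> \<Longrightarrow> (\<And>x. x \<in> Y \<Longrightarrow> 0 \<le> f x) \<Longrightarrow> 0 \<le> \<Lambda> f"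

text \<open>The gauge is the infimum of \<open>L\<close> over the polynomials that majorize a
  function on \<open>Y\<close>. Domination by it encodes both conclusions: 0 majorizes - f when f is
  nonnegative on \<open>Y\<close>, which gives positivity, and a polynomial and its negative
  majorize themselves, which gives agreement with \<open>L\<close>.\<close>

lemma extend_positive_functional:
  fixes L :: "'i mpolynomial \<Rightarrow> real"
  assumes add: "\<And>f g. f \<in> poly_alg \<Omega> \<Longrightarrow> g \<in> poly_alg \<Omega> \<Longrightarrow> L (f + g) = L f + L g"
    and scale: "\<And>c f. f \<in> poly_alg \<Omega> \<Longrightarrow> L (c *\<^sub>R f) = c * L f"
    and pos: "L ` Pos \<Omega> Y \<subseteq> {0..}"
  obtains \<Lambda> where "positive_functional \<Omega> Y \<Lambda>" "\<And>f. f \<in> poly_alg \<Omega> \<Longrightarrow> \<Lambda> (peval f) = L f"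
proof -
  note poly_alg_closed = add_in_poly_alg scaleR_in_poly_alg uminus_in_poly_alg diff_in_poly_alg zero_in_poly_alg
  define U where "U = (\<lambda>f. {g \<in> poly_alg \<Omega>. \<forall>x\<in>Y. f x \<le> peval g x})"
  define p where "p = (\<lambda>f. INF g\<in>U f. L g)"
  have L_neg: "L (- f) = - L f" if "f \<in> poly_alg \<Omega>" for f
    using scale[OF that, of "-1"] by simp
  have L_mono: "L f \<le> L g" if "f \<in> poly_alg \<Omega>" "g \<in> poly_alg \<Omega>" "\<And>x. x \<in> Y \<Longrightarrow> peval f x \<le> peval g x" for f g
  proof -
    have "g - f \<in> Pos \<Omega> Y" using that by (simp add: Pos_def peval_diff poly_alg_closed)
    then have "0 \<le> L (g - f)" using pos by auto
    moreover have "L ((g - f) + f) = L (g - f) + L f" using that by (intro add poly_alg_closed)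
    ultimately show ?thesis by simp
  qed
  have ne: "U f \<noteq> {}" if "f \<in> poly_bounded \<Omega>" for f
    using that by (force simp: poly_bounded_def U_def abs_le_iff)
  have bdd: "bdd_below (L ` U f)" if f: "f \<in> poly_bounded \<Omega>" for f
  proof -
    obtain g where g: "g \<in> poly_alg \<Omega>" "\<And>x. \<bar>f x\<bar> \<le> peval g x"
      using f by (auto simp: poly_bounded_def)
    \<comment> \<open>The polynomial - g lies below f and hence, on \<open>Y\<close>, below every
      majorant of f, so the infimum is finite.\<close>
    have "L (- g) \<le> L h" if "h \<in> U f" for h
    proof (rule L_mono)
      show "peval (- g) x \<le> peval h x" if "x \<in> Y" for x
        using that \<open>h \<in> U f\<close> g(2)[of x] by (force simp: U_def peval_uminus)
    qed (use g that in \<open>auto simp: U_def poly_alg_closed\<close>)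
    then show ?thesis by (intro bdd_belowI2)
  qed
  have le: "p f \<le> L g" if "f \<in> poly_bounded \<Omega>" "g \<in> U f" for f g
    unfolding p_def using bdd that by (intro cINF_lower)
  have ge: "b \<le> p f" if "f \<in> poly_bounded \<Omega>" "\<And>g. g \<in> U f \<Longrightarrow> b \<le> L g" for b f
    unfolding p_def using ne that by (intro cINF_greatest)
  have "sublinear_on (poly_bounded \<Omega>) p"
    unfolding sublinear_on_def
  proof (intro conjI ballI allI impI)
    fix f g assume fg: "f \<in> poly_bounded \<Omega>" "g \<in> poly_bounded \<Omega>"
    have *: "p (f + g) \<le> L u + L v" if "u \<in> U f" "v \<in> U g" for u v
    proof -
      have "u + v \<in> U (f + g)"
        using that by (auto simp: U_def peval_add poly_alg_closed intro: add_mono)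
      then have "p (f + g) \<le> L (u + v)"
        using fg by (intro le subspace_add[OF subspace_poly_bounded])
      then show ?thesis using that add by (auto simp: U_def)
    qed
    have "p (f + g) - p g \<le> p f"
    proof (rule ge[OF fg(1)])
      fix u assume u: "u \<in> U f"
      have "p (f + g) - L u \<le> p g"
        by (rule ge[OF fg(2)]) (use *[OF u] in \<open>simp add: algebra_simps\<close>)
      then show "p (f + g) - p g \<le> L u" by linarith
    qed
    then show "p (f + g) \<le> p f + p g" by linarith
  next
    fix c :: real and f assume c: "c > 0" and f: "f \<in> poly_bounded \<Omega>"
    have "p (c *\<^sub>R f) / c \<le> p f"
    proof (rule ge[OF f])
      fix u assume u: "u \<in> U f"
      have "c *\<^sub>R u \<in> U (c *\<^sub>R f)"
        using u c by (auto simp: U_def peval_scaleR poly_alg_closed)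
      then have "p (c *\<^sub>R f) \<le> L (c *\<^sub>R u)"
        using f by (intro le subspace_scale[OF subspace_poly_bounded])
      then show "p (c *\<^sub>R f) / c \<le> L u" using c u scale by (auto simp: U_def field_simps)
    qed
    then show "p (c *\<^sub>R f) \<le> c * p f" using c by (simp add: field_simps)
  qed
  then obtain \<Lambda> where \<Lambda>: "\<And>f g. f \<in> poly_bounded \<Omega> \<Longrightarrow> g \<in> poly_bounded \<Omega> \<Longrightarrow> \<Lambda> (f + g) = \<Lambda> f + \<Lambda> g"
    "\<And>c f. f \<in> poly_bounded \<Omega> \<Longrightarrow> \<Lambda> (c *\<^sub>R f) = c * \<Lambda> f"
    "\<And>f. f \<in> poly_bounded \<Omega> \<Longrightarrow> \<Lambda> f \<le> p f"
    using hahn_banach_dominated[OF subspace_poly_bounded] by metis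
  have neg: "\<Lambda> (- f) = - \<Lambda> f" if "f \<in> poly_bounded \<Omega>" for f
    using \<Lambda>(2)[OF that, of "-1"] by simp
  have le_L: "\<Lambda> f \<le> L g" if "f \<in> poly_bounded \<Omega>" "g \<in> U f" for f g
    using \<Lambda>(3) le that by (meson order_trans)
  have L0: "L 0 = 0" using scale[OF zero_in_poly_alg, of 0] by simp
  show ?thesis
  proof
    show "positive_functional \<Omega> Y \<Lambda>"
    proof
      show "\<Lambda> (\<lambda>x. f x + g x) = \<Lambda> f + \<Lambda> g" if "f \<in> poly_bounded \<Omega>" "g \<in> poly_bounded \<Omega>" for f g
        using \<Lambda>(1)[OF that] by (simp add: plus_fun_def)
      show "\<Lambda> (\<lambda>x. c * f x) = c * \<Lambda> f" if "f \<in> poly_bounded \<Omega>" for c f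
        using \<Lambda>(2)[OF that] by (simp add: scaleR_fun_def)
      show "0 \<le> \<Lambda> f" if "f \<in> poly_bounded \<Omega>" "\<And>x. x \<in> Y \<Longrightarrow> 0 \<le> f x" for f
      proof -
        have "\<Lambda> (- f) \<le> L 0"
          using that
          by (intro le_L subspace_neg[OF subspace_poly_bounded]) (auto simp: U_def poly_alg_closed)
        then show ?thesis using L0 neg[OF that(1)] by simp
      qed
    qed
    show "\<Lambda> (peval f) = L f" if f: "f \<in> poly_alg \<Omega>" for f
    proof (rule antisym)
      have W: "peval f \<in> poly_bounded \<Omega>" using f by (rule peval_poly_bounded)
      show "\<Lambda> (peval f) \<le> L f" using W f by (intro le_L) (auto simp: U_def)
      have "\<Lambda> (- peval f) \<le> L (- f)"
        using W f
        by (intro le_L subspace_neg[OF subspace_poly_bounded])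
          (auto simp: U_def poly_alg_closed peval_uminus)
      then show "L f \<le> \<Lambda> (peval f)" using neg[OF W] L_neg[OF f] by simp
    qed
  qed
qed

section \<open>Measures on Cantor cubes\<close>

definition cylinders :: "('j \<Rightarrow> bool) set set" where
  "cylinders = {A. \<exists>F. finite F \<and> (\<forall>b c. (\<forall>j\<in>F. b j = c j) \<longrightarrow> (b \<in> A \<longleftrightarrow> c \<in> A))}"

lemma cylindersI:
  assumes "finite F" "\<And>b c. (\<And>j. j \<in> F \<Longrightarrow> b j = c j) \<Longrightarrow> b \<in> A \<Longrightarrow> c \<in> A"
  shows "A \<in> cylinders"
  unfolding cylinders_def using assms by (auto intro!: exI[of _ F])

lemma cylinders_algebra: "algebra UNIV (cylinders :: ('j \<Rightarrow> bool) set set)"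
proof (rule algebra_iff_Un[THEN iffD2], intro conjI ballI)
  show "{} \<in> (cylinders :: ('j \<Rightarrow> bool) set set)"
    by (rule cylindersI[of "{}"]) auto
  fix A :: "('j \<Rightarrow> bool) set" assume "A \<in> cylinders"
  then obtain F where F: "finite F" "\<And>b c. (\<forall>j\<in>F. b j = c j) \<Longrightarrow> b \<in> A \<longleftrightarrow> c \<in> A"
    by (auto simp: cylinders_def)
  show "UNIV - A \<in> cylinders"
    using F by (intro cylindersI[of F]) auto
  fix B :: "('j \<Rightarrow> bool) set" assume "B \<in> cylinders"
  then obtain G where G: "finite G" "\<And>b c. (\<forall>j\<in>G. b j = c j) \<Longrightarrow> b \<in> B \<longleftrightarrow> c \<in> B"
    by (auto simp: cylinders_def)
  show "A \<union> B \<in> cylinders"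
    using F G by (intro cylindersI[of "F \<union> G"]) (auto, metis+)
qed auto

text \<open>Tychonoff's theorem for discrete two-point factors, with an index type of any
  cardinality.\<close>

lemma compact_bool_power: "compact (UNIV :: ('j \<Rightarrow> bool) set)"
proof -
  have "compact_space (euclidean :: bool topology)"
    by (simp add: compact_space_def compactin_euclidean_iff finite_imp_compact)
  then have "compact_space (product_topology (\<lambda>_. euclidean :: bool topology) (UNIV :: 'j set))"
    by (simp add: compact_space_product_topology)
  then show ?thesis
    by (simp add: euclidean_product_topology compact_space_def compactin_euclidean_iff)
qed

lemma closed_cylinder:
  assumes "A \<in> (cylinders :: ('j \<Rightarrow> bool) set set)"
  shows "closed A"
proof -
  obtain F where F: "finite F" "\<And>b c. (\<forall>j\<in>F. b j = c j) \<Longrightarrow> b \<in> A \<longleftrightarrow> c \<in> A"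
    using assms by (auto simp: cylinders_def)
  have "open (- A)"
  proof (subst open_subopen, safe)
    fix b assume b: "b \<notin> A"
    have "open (\<Inter>j\<in>F. (\<lambda>c. c j) -` {b j})"
      using F(1) by (intro open_INT ballI open_vimage open_discrete continuous_on_product_coordinates)
    moreover have "(\<Inter>j\<in>F. (\<lambda>c. c j) -` {b j}) \<subseteq> - A"
      using F(2)[of _ b] b by auto
    ultimately show "\<exists>T. open T \<and> b \<in> T \<and> T \<subseteq> - A"
      by (intro exI[of _ "\<Inter>j\<in>F. (\<lambda>c. c j) -` {b j}"]) auto
  qed
  then show ?thesis by (simp add: closed_def)
qed

text \<open>Countable additivity is automatic: cylinders in a Cantor cube are compact, so a decreasing
  sequence of them with empty intersection is eventually empty.\<close>

lemma cylinder_measure_exists: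
  fixes m :: "('j \<Rightarrow> bool) set \<Rightarrow> real"
  assumes nonneg: "\<And>A. 0 \<le> m A"
    and add: "\<And>A B. A \<inter> B = {} \<Longrightarrow> m (A \<union> B) = m A + m B"
  obtains \<mu> where "sets \<mu> = sigma_sets UNIV cylinders" "finite_measure \<mu>"
    "\<And>A. A \<in> cylinders \<Longrightarrow> measure \<mu> A = m A"
proof -
  interpret algebra UNIV "cylinders :: ('j \<Rightarrow> bool) set set" by (rule cylinders_algebra)
  let ?f = "\<lambda>A. ennreal (m A)"
  have m0: "m {} = 0" using add[of "{}" "{}"] by simp
  have "\<exists>\<mu>. (\<forall>s\<in>cylinders. \<mu> s = ?f s) \<and> measure_space UNIV (sigma_sets UNIV cylinders) \<mu>"
  proof (rule caratheodory_empty_continuous)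
    show "positive cylinders ?f" by (simp add: positive_def m0)
    show "additive cylinders ?f" by (simp add: additive_def add nonneg)
    fix A :: "nat \<Rightarrow> ('j \<Rightarrow> bool) set"
    assume A: "range A \<subseteq> cylinders" "decseq A" "(\<Inter>i. A i) = {}"
    have "\<exists>n. A n = {}"
    proof (rule ccontr)
      assume ne: "\<not> (\<exists>n. A n = {})"
      have "UNIV \<inter> \<Inter>(range A) \<noteq> {}"
      proof (rule compact_imp_fip[OF compact_bool_power])
        show "closed T" if "T \<in> range A" for T using that A(1) closed_cylinder by auto
        fix F' assume "finite F'" "F' \<subseteq> range A"
        then obtain I where I: "finite I" "F' = A ` I" by (meson finite_subset_image)
        obtain N where "\<forall>i\<in>I. i \<le> N" using I(1) finite_nat_set_iff_bounded_le by auto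
        then have "A N \<subseteq> \<Inter> F'" using A(2) I by (auto simp: decseq_def)
        then show "UNIV \<inter> \<Inter> F' \<noteq> {}" using ne by auto
      qed
      then show False using A(3) by auto
    qed
    then obtain n where n: "A n = {}" by auto
    have "\<forall>\<^sub>F i in sequentially. ?f (A i) = 0"
      using eventually_ge_at_top[of n]
    proof eventually_elim
      case (elim i)
      then have "A i \<subseteq> A n" using A(2) by (auto simp: decseq_def)
      then show ?case using n m0 by simp
    qed
    then show "(\<lambda>i. ?f (A i)) \<longlonglongrightarrow> 0" by (rule tendsto_eventually)
  qed auto
  then obtain \<mu> where \<mu>: "\<And>A. A \<in> cylinders \<Longrightarrow> \<mu> A = ?f A"
    "measure_space UNIV (sigma_sets UNIV cylinders) \<mu>" by auto
  define M where "M = measure_of UNIV cylinders \<mu>"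
  have em: "emeasure M A = ?f A" if "A \<in> cylinders" for A
  proof -
    have "emeasure M A = \<mu> A"
      using \<mu>(2) that
      by (intro emeasure_measure_of[OF M_def]) (auto simp: M_def measure_space_def)
    then show ?thesis using \<mu>(1) that by simp
  qed
  show ?thesis
  proof
    show "sets M = sigma_sets UNIV cylinders"
      by (simp add: M_def sets_measure_of_conv)
    have "space M = UNIV" by (simp add: M_def space_measure_of_conv)
    then show "finite_measure M" using em[of UNIV] top by (intro finite_measureI) simp
    show "measure M A = m A" if "A \<in> cylinders" for A
      using em[OF that] nonneg by (simp add: measure_def)
  qed
qed

text \<open>Finitely many bits leave finitely many values, each attained on a cylinder. The integral
  thus involves the measure only on cylinders, where it is prescribed.\<close>

lemma cylinder_function_integral:
  fixes H :: "('j \<Rightarrow> bool) \<Rightarrow> real"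
  assumes sets: "sets \<mu> = sigma_sets UNIV cylinders" and fin: "finite_measure \<mu>"
    and F: "finite F" "\<And>b c. (\<And>j. j \<in> F \<Longrightarrow> b j = c j) \<Longrightarrow> H b = H c"
  shows "finite (range H)" "H -` {r} \<in> cylinders" "integrable \<mu> H"
    "integral\<^sup>L \<mu> H = (\<Sum>r\<in>range H. r * measure \<mu> (H -` {r}))"
proof -
  interpret finite_measure \<mu> by fact
  \<comment> \<open>A bit pattern on \<open>F\<close> is encoded by the subset where it is true,
    extended by \<open>False\<close> outside \<open>F\<close>.\<close>
  have "range H \<subseteq> (\<lambda>S. H (\<lambda>j. j \<in> S)) ` Pow F"
  proof safe
    fix b
    have "H b = H (\<lambda>j. j \<in> {j\<in>F. b j})" by (rule F(2)) auto
    then show "H b \<in> (\<lambda>S. H (\<lambda>j. j \<in> S)) ` Pow F" by blast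
  qed
  then show fr: "finite (range H)" using F(1) by (meson finite_Pow_iff finite_surj)
  show cyl: "H -` {r} \<in> cylinders" for r
  proof (rule cylindersI[OF F(1)])
    fix b c :: "'j \<Rightarrow> bool" assume "\<And>j. j \<in> F \<Longrightarrow> b j = c j" "b \<in> H -` {r}"
    then show "c \<in> H -` {r}" using F(2)[of b c] by simp
  qed
  have [measurable]: "H -` {r} \<in> sets \<mu>" for r using cyl sets by auto
  have eq: "H = (\<lambda>b. \<Sum>r\<in>range H. r * indicator (H -` {r}) b)"
    by (rule ext, subst sum.remove[OF fr]) (auto intro!: sum.neutral simp: indicator_def)
  have int: "integrable \<mu> (\<lambda>b. r * indicator (H -` {r}) b)" for r
    by (intro integrable_mult_right integrable_real_indicator) (auto simp: emeasure_finite less_top[symmetric])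
  show "integrable \<mu> H" by (subst eq) (intro Bochner_Integration.integrable_sum int)
  have "integral\<^sup>L \<mu> H = (\<Sum>r\<in>range H. integral\<^sup>L \<mu> (\<lambda>b. r * indicator (H -` {r}) b))"
    by (subst eq) (intro Bochner_Integration.integral_sum int)
  also have "\<dots> = (\<Sum>r\<in>range H. r * measure \<mu> (H -` {r}))"
    using sets_eq_imp_space_eq[of \<mu> "sigma UNIV cylinders"] sets
    by simp
  finally show "integral\<^sup>L \<mu> H = (\<Sum>r\<in>range H. r * measure \<mu> (H -` {r}))" .
qed

section \<open>Binary truncations\<close>

text \<open>At coordinate i, index None carries the sign and index Some k the binary digit of weight 2^k.
  Unlike thresholds, the digits satisfy no relations, so every sequence is admissible and truncations
  of all of them are monotone in absolute value.\<close>

definition truncation :: "nat \<Rightarrow> ('i \<times> int option \<Rightarrow> bool) \<Rightarrow> 'i \<Rightarrow> real" where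
  "truncation n b i = (if b (i, None) then -1 else 1) *
     (\<Sum>k\<in>{- int n..int n}. of_bool (b (i, Some k)) * 2 powi k)"

definition digits :: "('i \<Rightarrow> real) \<Rightarrow> 'i \<times> int option \<Rightarrow> bool" where
  "digits x = (\<lambda>(i, k). case k of None \<Rightarrow> x i < 0 | Some k \<Rightarrow> odd \<lfloor>\<bar>x i\<bar> / 2 powi k\<rfloor>)"

lemma abs_truncation:
  "\<bar>truncation n b i\<bar> = (\<Sum>k\<in>{- int n..int n}. of_bool (b (i, Some k)) * 2 powi k)"
  unfolding truncation_def abs_mult by (subst abs_of_nonneg, rule sum_nonneg) auto

lemma abs_truncation_mono: "n \<le> n' \<Longrightarrow> \<bar>truncation n b i\<bar> \<le> \<bar>truncation n' b i\<bar>"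
  unfolding abs_truncation by (rule sum_mono2) auto

text \<open>The sign bit does not depend on n, so it is enough that the absolute values are monotone
  and bounded.\<close>

lemma truncation_convergent:
  assumes "\<And>n. \<bar>truncation n b i\<bar> \<le> C"
  shows "convergent (\<lambda>n. truncation n b i)"
proof -
  have "convergent (\<lambda>n. \<bar>truncation n b i\<bar>)"
    using assms by (intro Bseq_mono_convergent BseqI'[of _ C]) (auto intro: abs_truncation_mono)
  then have "convergent (\<lambda>n. (if b (i, None) then -1 else 1) * \<bar>truncation n b i\<bar>)"
    by (intro convergent_mult convergent_const)
  then show ?thesis unfolding abs_truncation by (simp add: truncation_def)
qed

text \<open>Absolute values increase to their limit. This makes the limiting point itself the source
  of the dominating functions used later.\<close>

lemma abs_truncation_le_lim:
  assumes "convergent (\<lambda>n. truncation n b i)"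
  shows "\<bar>truncation n b i\<bar> \<le> \<bar>lim (\<lambda>n. truncation n b i)\<bar>"
proof (rule LIMSEQ_le_const)
  show "(\<lambda>n. \<bar>truncation n b i\<bar>) \<longlonglongrightarrow> \<bar>lim (\<lambda>n. truncation n b i)\<bar>"
    using assms by (intro tendsto_rabs) (simp add: convergent_LIMSEQ_iff)
qed (auto intro: abs_truncation_mono)

text \<open>The lowest bit of an integer c is c - 2 (c div 2), and halving commutes with the floor
  in this sense. A weighted digit is thus a difference of consecutive terms, and digit sums
  telescope.\<close>

lemma digit_telescope:
  fixes y :: real
  shows "of_bool (odd \<lfloor>y / 2 powi k\<rfloor>) * 2 powi k
    = \<lfloor>y / 2 powi k\<rfloor> * 2 powi k - \<lfloor>y / 2 powi (k + 1)\<rfloor> * 2 powi (k + 1)"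
proof -
  have "y / 2 powi (k + 1) = (y / 2 powi k) / 2"
    by (simp add: power_int_add)
  moreover have "\<lfloor>z / 2\<rfloor> = \<lfloor>z\<rfloor> div 2" for z :: real
    using floor_divide_real_eq_div[of 2 z] by simp
  ultimately have "\<lfloor>y / 2 powi (k + 1)\<rfloor> = \<lfloor>y / 2 powi k\<rfloor> div 2" by metis
  moreover have "of_bool (odd c) = c - 2 * (c div 2)" for c :: int
    by (simp add: minus_mult_div_eq_mod of_bool_odd_eq_mod_2)
  ultimately have "(of_bool (odd \<lfloor>y / 2 powi k\<rfloor>) :: int) = \<lfloor>y / 2 powi k\<rfloor> - 2 * \<lfloor>y / 2 powi (k + 1)\<rfloor>"
    by metis
  then have e: "(of_bool (odd \<lfloor>y / 2 powi k\<rfloor>) :: real) = \<lfloor>y / 2 powi k\<rfloor> - 2 * \<lfloor>y / 2 powi (k + 1)\<rfloor>"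
    by (metis (no_types) of_int_diff of_int_mult of_int_numeral of_int_of_bool)
  show ?thesis unfolding e by (simp add: power_int_add algebra_simps)
qed

lemma abs_truncation_digits:
  "\<bar>truncation n (digits x) i\<bar> = \<lfloor>\<bar>x i\<bar> / 2 powi (- int n)\<rfloor> * 2 powi (- int n)
    - \<lfloor>\<bar>x i\<bar> / 2 powi (int n + 1)\<rfloor> * 2 powi (int n + 1)"
proof -
  let ?y = "\<bar>x i\<bar>"
  have *: "(\<Sum>k\<in>{- int n..int n}. of_bool (odd \<lfloor>?y / 2 powi k\<rfloor>) * 2 powi k)
    = \<lfloor>?y / 2 powi (- int n)\<rfloor> * 2 powi (- int n) - \<lfloor>?y / 2 powi (int n + 1)\<rfloor> * 2 powi (int n + 1)"
  proof (induction n)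
    case 0
    then show ?case using digit_telescope[of ?y 0] by simp
  next
    case (Suc n)
    have e: "- int (Suc n) = - int n - 1" "int (Suc n) = int n + 1" "- int n - 1 + 1 = - int n"
      by simp_all
    \<comment> \<open>Passing to the next n appends one digit at each end, so the telescoping sum
      grows on both sides.\<close>
    have "{- int (Suc n)..int (Suc n)} = insert (- int n - 1) (insert (int n + 1) {- int n..int n})"
      by auto
    then have "(\<Sum>k\<in>{- int (Suc n)..int (Suc n)}. of_bool (odd \<lfloor>?y / 2 powi k\<rfloor>) * 2 powi k :: real)
      = of_bool (odd \<lfloor>?y / 2 powi (- int n - 1)\<rfloor>) * 2 powi (- int n - 1)
        + (of_bool (odd \<lfloor>?y / 2 powi (int n + 1)\<rfloor>) * 2 powi (int n + 1)
        + (\<Sum>k\<in>{- int n..int n}. of_bool (odd \<lfloor>?y / 2 powi k\<rfloor>) * 2 powi k))"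
      by (simp only:) (subst sum.insert; simp)+
    then show ?case
      unfolding e Suc.IH unfolding digit_telescope e by simp
  qed
  show ?thesis unfolding abs_truncation by (simp add: digits_def * )
qed

text \<open>Digits below weight 2^-n cost at most 2^-n. Digits above weight 2^n matter only if |x i|
  \<ge> 2^(n+1), and then |x i| is at most its square over 2^(n+1). The quadratic factor buys a rate
  valid on an unbounded coordinate, which is the form a merely positive functional can use.\<close>

lemma truncation_digits:
  shows "\<bar>truncation n (digits x) i\<bar> \<le> \<bar>x i\<bar>"
    and "\<bar>truncation n (digits x) i - x i\<bar> \<le> (1 + (x i)\<^sup>2) / 2 ^ n"
proof -
  let ?y = "\<bar>x i\<bar>"
  let ?a = "\<lfloor>?y / 2 powi (- int n)\<rfloor> * 2 powi (- int n)"
  let ?c = "\<lfloor>?y / 2 powi (int n + 1)\<rfloor> * 2 powi (int n + 1) :: real"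
  have pow: "2 powi (- int n) = (1 / 2 ^ n :: real)" by (simp add: power_int_minus field_simps)
  have a: "?a \<le> ?y" "?y - 1 / 2 ^ n \<le> ?a"
  proof -
    have "\<lfloor>?y * 2 ^ n\<rfloor> \<le> ?y * 2 ^ n" "?y * 2 ^ n - 1 \<le> \<lfloor>?y * 2 ^ n\<rfloor>" by linarith+
    then have "\<lfloor>?y * 2 ^ n\<rfloor> / 2 ^ n \<le> ?y * 2 ^ n / 2 ^ n" "(?y * 2 ^ n - 1) / 2 ^ n \<le> \<lfloor>?y * 2 ^ n\<rfloor> / 2 ^ n"
      by (intro divide_right_mono; simp)+
    then show "?a \<le> ?y" "?y - 1 / 2 ^ n \<le> ?a"
      by (simp_all add: pow diff_divide_distrib)
  qed
  have c0: "0 \<le> ?c" by simp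
  have c1: "?c \<le> (x i)\<^sup>2 / 2 ^ n"
  proof (cases "?c = 0")
    case False
    define N :: real where "N = 2 powi (int n + 1)"
    have N: "N > 0" by (simp add: N_def)
    have "\<lfloor>?y / N\<rfloor> \<ge> 1" using False c0 unfolding N_def
      by (smt (verit) mult_eq_0_iff of_int_0_eq_iff zero_le_floor divide_nonneg_nonneg zero_le_power_int)
    then have yN: "?y \<ge> N" using N by (simp add: le_floor_iff field_simps)
    have "\<lfloor>?y / N\<rfloor> * N \<le> ?y" using N floor_divide_lower[of N ?y] by (simp add: mult.commute)
    moreover have "?y * N \<le> ?y * ?y" using yN by (intro mult_left_mono) auto
    then have "?y \<le> (x i)\<^sup>2 / N" using N by (simp add: field_simps power2_eq_square)
    moreover have "(x i)\<^sup>2 / N \<le> (x i)\<^sup>2 / 2 ^ n"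
      by (intro divide_left_mono) (auto simp: N_def power_int_add)
    ultimately show ?thesis by (simp add: N_def)
  qed simp
  show 1: "\<bar>truncation n (digits x) i\<bar> \<le> \<bar>x i\<bar>"
    unfolding abs_truncation_digits using a(1) c0 by linarith
  have "\<bar>\<bar>truncation n (digits x) i\<bar> - \<bar>x i\<bar>\<bar> \<le> 1 / 2 ^ n + (x i)\<^sup>2 / 2 ^ n"
    unfolding abs_truncation_digits using a c0 c1 by linarith
  moreover have "\<bar>truncation n (digits x) i - x i\<bar> = \<bar>\<bar>truncation n (digits x) i\<bar> - \<bar>x i\<bar>\<bar>"
  proof -
    have "truncation n (digits x) i = (if x i < 0 then -1 else 1) * \<bar>truncation n (digits x) i\<bar>"
      unfolding abs_truncation by (simp add: truncation_def digits_def)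
    then show ?thesis by (cases "x i < 0"; simp; linarith)
  qed
  ultimately show "\<bar>truncation n (digits x) i - x i\<bar> \<le> (1 + (x i)\<^sup>2) / 2 ^ n"
    by (simp add: add_divide_distrib)
qed

section \<open>The digit measure of a positive functional\<close>

context positive_functional
begin

lemma mono:
  assumes "f \<in> poly_bounded \<Omega>" "g \<in> poly_bounded \<Omega>" "\<And>x. x \<in> Y \<Longrightarrow> f x \<le> g x"
  shows "\<Lambda> f \<le> \<Lambda> g"
proof -
  have h: "(\<lambda>x. g x + (-1) * f x) \<in> poly_bounded \<Omega>"
    by (intro poly_bounded_add poly_bounded_mult poly_bounded_const assms)
  have "0 \<le> \<Lambda> (\<lambda>x. g x + (-1) * f x)" using assms(3) by (intro pos[OF h]) auto
  also have "\<dots> = \<Lambda> g + \<Lambda> (\<lambda>x. (-1) * f x)"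
    by (intro add poly_bounded_mult poly_bounded_const assms)
  finally show ?thesis using scale[OF assms(1), of "-1"] by simp
qed

lemma vanish:
  assumes "f \<in> poly_bounded \<Omega>" "\<And>x. x \<in> Y \<Longrightarrow> f x = 0"
  shows "\<Lambda> f = 0"
proof (rule antisym)
  \<comment> \<open>Zero is written as \<open>0 * 0\<close> so that homogeneity with factor 0
    evaluates it.\<close>
  have "\<Lambda> f \<le> \<Lambda> (\<lambda>_. 0 * 0)" using assms by (intro mono poly_bounded_const) auto
  then show "\<Lambda> f \<le> 0" using scale[OF poly_bounded_const[of 0], of 0] by simp
qed (use assms in \<open>intro pos; simp\<close>)

text \<open>Membership travels with the equation, since additivity applies to a partial sum only
  once that sum is known to be polynomially bounded.\<close>

lemma sum:
  assumes "\<And>a. a \<in> A \<Longrightarrow> f a \<in> poly_bounded \<Omega>"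
  shows "\<Lambda> (\<lambda>x. \<Sum>a\<in>A. f a x) = (\<Sum>a\<in>A. \<Lambda> (f a)) \<and> (\<lambda>x. \<Sum>a\<in>A. f a x) \<in> poly_bounded \<Omega>"
  using assms
proof (induction A rule: infinite_finite_induct)
  case (insert a A)
  then show ?case by (simp add: add poly_bounded_add)
qed (auto intro: vanish poly_bounded_const)

text \<open>This is the substitute for continuity: an error dominated pointwise by \<open>h\<close>
  costs at most \<open>\<Lambda> h\<close>.\<close>

lemma diff_bound:
  assumes "f \<in> poly_bounded \<Omega>" "g \<in> poly_bounded \<Omega>" "h \<in> poly_bounded \<Omega>"
    "\<And>x. \<bar>f x - g x\<bar> \<le> h x"
  shows "\<bar>\<Lambda> f - \<Lambda> g\<bar> \<le> \<Lambda> h"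
proof -
  have "\<Lambda> f \<le> \<Lambda> (\<lambda>x. g x + h x)" "\<Lambda> g \<le> \<Lambda> (\<lambda>x. f x + h x)"
    using assms(4) by (auto intro!: mono poly_bounded_add assms(1-3) simp: abs_le_iff algebra_simps)
  then show ?thesis by (auto simp: add assms(1-3) abs_le_iff)
qed

lemma indicator_poly_bounded: "(\<lambda>x. indicator A (\<phi> x)) \<in> poly_bounded \<Omega>"
  by (rule poly_bounded_mono[OF poly_bounded_const[of 1]]) (auto simp: indicator_def)

end

text \<open>One \<open>H\<close> bounds both the truncated values and the scaled error. The bound on
  the values makes the class closed under products, so that polynomials are reached from
  coordinates; it also keeps the truncated function, which need not be polynomial, in the domain of
  the functional.\<close>

definition truncation_approximable :: "'i set \<Rightarrow> (('i \<Rightarrow> real) \<Rightarrow> real) \<Rightarrow> bool" where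
  "truncation_approximable \<Omega> h \<longleftrightarrow> h \<in> poly_bounded \<Omega> \<and>
     (\<exists>H\<in>poly_bounded \<Omega>. \<forall>n x. \<bar>h (truncation n (digits x))\<bar> \<le> H x \<and>
        \<bar>h (truncation n (digits x)) - h x\<bar> \<le> H x / 2 ^ n)"

lemma truncation_approximable_const: "truncation_approximable \<Omega> (\<lambda>_. c)"
  unfolding truncation_approximable_def
  by (auto intro!: poly_bounded_const bexI[of _ "\<lambda>_. \<bar>c\<bar>"])

lemma truncation_approximable_coordinate:
  assumes "i \<in> \<Omega>"
  shows "truncation_approximable \<Omega> (\<lambda>x. x i)"
proof -
  have x: "(\<lambda>x. x i) \<in> poly_bounded \<Omega>"
  proof -
    have "peval (pvar i) = (\<lambda>x. x i)" by (rule ext) simp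
    then show ?thesis using peval_poly_bounded[OF pvar_in_poly_alg[OF assms]] by simp
  qed
  \<comment> \<open>The numerator of the truncation error also bounds |x i|, so one function serves
    both requirements.\<close>
  then have "(\<lambda>x. 1 + x i * x i) \<in> poly_bounded \<Omega>"
    by (intro poly_bounded_add poly_bounded_mult poly_bounded_const)
  moreover have "\<bar>t\<bar> \<le> 1 + t * t" for t :: real
  proof -
    have "0 \<le> (\<bar>t\<bar> - 1)\<^sup>2" by simp
    then have "2 * \<bar>t\<bar> \<le> 1 + t * t" by (simp add: power2_eq_square algebra_simps)
    then show ?thesis by linarith
  qed
  then have "\<bar>truncation n (digits x) i\<bar> \<le> 1 + x i * x i" for n and x :: "'a \<Rightarrow> real"
    using truncation_digits(1)[of n x i] by (meson order_trans)
  ultimately show ?thesis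
    unfolding truncation_approximable_def
    using x truncation_digits(2) by (auto intro!: bexI[of _ "\<lambda>x. 1 + x i * x i"] simp: power2_eq_square)
qed

lemma truncation_approximable_add:
  assumes "truncation_approximable \<Omega> f" "truncation_approximable \<Omega> g"
  shows "truncation_approximable \<Omega> (\<lambda>x. f x + g x)"
proof -
  obtain F G where FG: "F \<in> poly_bounded \<Omega>" "G \<in> poly_bounded \<Omega>"
    "\<And>n x. \<bar>f (truncation n (digits x))\<bar> \<le> F x" "\<And>n x. \<bar>g (truncation n (digits x))\<bar> \<le> G x"
    "\<And>n x. \<bar>f (truncation n (digits x)) - f x\<bar> \<le> F x / 2 ^ n"
    "\<And>n x. \<bar>g (truncation n (digits x)) - g x\<bar> \<le> G x / 2 ^ n"
    using assms unfolding truncation_approximable_def by metis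
  show ?thesis
    unfolding truncation_approximable_def
  proof (intro conjI bexI[of _ "\<lambda>x. F x + G x"] allI)
    fix n and x :: "'a \<Rightarrow> real"
    show "\<bar>f (truncation n (digits x)) + g (truncation n (digits x))\<bar> \<le> F x + G x"
      using FG(3,4)[of n x] by linarith
    show "\<bar>f (truncation n (digits x)) + g (truncation n (digits x)) - (f x + g x)\<bar> \<le> (F x + G x) / 2 ^ n"
      using FG(5,6)[of n x] unfolding add_divide_distrib by linarith
  qed (use assms FG in \<open>auto simp: truncation_approximable_def intro: poly_bounded_add\<close>)
qed

lemma truncation_approximable_mult:
  assumes "truncation_approximable \<Omega> f" "truncation_approximable \<Omega> g"
  shows "truncation_approximable \<Omega> (\<lambda>x. f x * g x)"
proof -
  obtain F G where FG: "F \<in> poly_bounded \<Omega>" "G \<in> poly_bounded \<Omega>"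
    "\<And>n x. \<bar>f (truncation n (digits x))\<bar> \<le> F x" "\<And>n x. \<bar>g (truncation n (digits x))\<bar> \<le> G x"
    "\<And>n x. \<bar>f (truncation n (digits x)) - f x\<bar> \<le> F x / 2 ^ n"
    "\<And>n x. \<bar>g (truncation n (digits x)) - g x\<bar> \<le> G x / 2 ^ n"
    using assms unfolding truncation_approximable_def by metis
  have W: "f \<in> poly_bounded \<Omega>" "g \<in> poly_bounded \<Omega>"
    using assms by (auto simp: truncation_approximable_def)
  \<comment> \<open>The summands match the splitting of the product error: truncated f times the
    error of g, plus g times the error of f. The first alone bounds the truncated product.\<close>
  define H where "H = (\<lambda>x. F x * G x + \<bar>g x\<bar> * F x)"
  show ?thesis
    unfolding truncation_approximable_def
  proof (intro conjI bexI[of _ H] allI)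
    fix n and x :: "'a \<Rightarrow> real"
    let ?T = "truncation n (digits x)"
    have F0: "0 \<le> F x" and G0: "0 \<le> G x" using FG(3,4)[of n x] by linarith+
    have "\<bar>f ?T * g ?T\<bar> \<le> F x * G x"
      unfolding abs_mult using FG(3,4)[of n x] F0 by (intro mult_mono) auto
    also have "\<dots> \<le> H x" using F0 by (simp add: H_def)
    finally show "\<bar>f ?T * g ?T\<bar> \<le> H x" .
    have "f ?T * g ?T - f x * g x = f ?T * (g ?T - g x) + g x * (f ?T - f x)"
      by (simp add: algebra_simps)
    also have "\<bar>\<dots>\<bar> \<le> \<bar>f ?T\<bar> * \<bar>g ?T - g x\<bar> + \<bar>g x\<bar> * \<bar>f ?T - f x\<bar>"
      unfolding abs_mult[symmetric] by (rule abs_triangle_ineq)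
    also have "\<dots> \<le> F x * (G x / 2 ^ n) + \<bar>g x\<bar> * (F x / 2 ^ n)"
      using FG(3-6)[of n x] F0 by (intro add_mono mult_mono) auto
    also have "\<dots> = H x / 2 ^ n" by (simp add: H_def add_divide_distrib)
    finally show "\<bar>f ?T * g ?T - f x * g x\<bar> \<le> H x / 2 ^ n" .
  qed (use W FG in \<open>auto simp: H_def intro!: poly_bounded_add poly_bounded_mult poly_bounded_abs\<close>)
qed

lemma truncation_approximable_power:
  "truncation_approximable \<Omega> f \<Longrightarrow> truncation_approximable \<Omega> (\<lambda>x. f x ^ k)"
  by (induction k) (auto intro: truncation_approximable_const truncation_approximable_mult)

lemma truncation_approximable_prod:
  "(\<And>a. a \<in> A \<Longrightarrow> truncation_approximable \<Omega> (f a)) \<Longrightarrow> truncation_approximable \<Omega> (\<lambda>x. \<Prod>a\<in>A. f a x)"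
  by (induction A rule: infinite_finite_induct)
    (auto intro: truncation_approximable_const truncation_approximable_mult)

lemma truncation_approximable_sum:
  "(\<And>a. a \<in> A \<Longrightarrow> truncation_approximable \<Omega> (f a)) \<Longrightarrow> truncation_approximable \<Omega> (\<lambda>x. \<Sum>a\<in>A. f a x)"
  by (induction A rule: infinite_finite_induct)
    (auto intro: truncation_approximable_const truncation_approximable_add)

lemma truncation_approximable_peval:
  assumes "f \<in> poly_alg \<Omega>"
  shows "truncation_approximable \<Omega> (peval f)"
proof -
  have "truncation_approximable \<Omega> (\<lambda>x. peval f x)"
    unfolding peval_def
    using assms by (intro truncation_approximable_sum truncation_approximable_mult
        truncation_approximable_const truncation_approximable_prod truncation_approximable_power
        truncation_approximable_coordinate) (auto simp: poly_alg_def)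
  then show ?thesis by simp
qed

text \<open>The measure is tied to the functional on cylinders alone, by pulling back along
  \<open>digits\<close>. It need not be concentrated on codes of the form
  \<open>digits x\<close>.\<close>

locale digit_measure = positive_functional \<Omega> Y \<Lambda>
  for \<Omega> :: "'i set" and Y :: "('i \<Rightarrow> real) set" and \<Lambda> :: "(('i \<Rightarrow> real) \<Rightarrow> real) \<Rightarrow> real" +
  fixes \<mu> :: "('i \<times> int option \<Rightarrow> bool) measure"
  assumes sets_mu: "sets \<mu> = sigma_sets UNIV cylinders"
    and finite_mu: "finite_measure \<mu>"
    and measure_mu: "A \<in> cylinders \<Longrightarrow> measure \<mu> A = \<Lambda> (\<lambda>x. indicator A (digits x))"
begin

sublocale finite_measure \<mu> by (rule finite_mu)

text \<open>Where truncations diverge, \<open>lim\<close> is an unspecified real. For coordinates in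
  \<open>\<Omega>\<close> this will be confined to a null set; the other coordinates are discarded
  later.\<close>

definition realize :: "('i \<times> int option \<Rightarrow> bool) \<Rightarrow> 'i \<Rightarrow> real" where
  "realize b = (\<lambda>i. lim (\<lambda>n. truncation n b i))"

text \<open>Both sides are the same combination of cylinder values over the level sets of
  \<open>H\<close>. This is the bridge between integration and \<open>\<Lambda>\<close>.\<close>

lemma simple_integral:
  assumes F: "finite F" "\<And>b c. (\<And>j. j \<in> F \<Longrightarrow> b j = c j) \<Longrightarrow> H b = H c"
  shows "integrable \<mu> H" "integral\<^sup>L \<mu> H = \<Lambda> (\<lambda>x. H (digits x))"
proof -
  have H: "finite (range H)" "\<And>r. H -` {r} \<in> cylinders" "integrable \<mu> H"
    "integral\<^sup>L \<mu> H = (\<Sum>r\<in>range H. r * measure \<mu> (H -` {r}))"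
    using cylinder_function_integral[OF sets_mu finite_mu F(1), of H] F(2) by blast+
  show "integrable \<mu> H" by (rule H(3))
  have "(\<lambda>x. H (digits x)) = (\<lambda>x. \<Sum>r\<in>range H. r * indicator (H -` {r}) (digits x))"
    by (rule ext, subst sum.remove[OF H(1)]) (auto intro!: sum.neutral simp: indicator_def)
  then have "\<Lambda> (\<lambda>x. H (digits x)) = \<Lambda> (\<lambda>x. \<Sum>r\<in>range H. r * indicator (H -` {r}) (digits x))"
    by simp
  also have "\<dots> = (\<Sum>r\<in>range H. \<Lambda> (\<lambda>x. r * indicator (H -` {r}) (digits x)))"
    by (intro sum[THEN conjunct1] poly_bounded_mult poly_bounded_const indicator_poly_bounded)
  also have "\<dots> = integral\<^sup>L \<mu> H"
    unfolding H(4) measure_mu[OF H(2)] by (intro sum.cong refl scale indicator_poly_bounded)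
  finally show "integral\<^sup>L \<mu> H = \<Lambda> (\<lambda>x. H (digits x))" ..
qed

text \<open>The n-th truncation of a coordinate reads its sign and 2n+1 digits, so finitely many
  truncated coordinates depend on finitely many bits.\<close>

lemma truncation_integral:
  assumes G: "finite G" "\<And>x y. (\<And>i. i \<in> G \<Longrightarrow> x i = y i) \<Longrightarrow> h x = h y"
  shows "integrable \<mu> (\<lambda>b. h (truncation n b))"
    "(\<integral>b. h (truncation n b) \<partial>\<mu>) = \<Lambda> (\<lambda>x. h (truncation n (digits x)))"
proof -
  let ?F = "G \<times> insert None (Some ` {- int n..int n})"
  have F: "finite ?F" using G(1) by simp
  have eq: "h (truncation n b) = h (truncation n c)" if "\<And>j. j \<in> ?F \<Longrightarrow> b j = c j" for b c
  proof (rule G(2))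
    fix i assume i: "i \<in> G"
    have "b (i, None) = c (i, None)" using that i by simp
    moreover have "(\<Sum>k\<in>{- int n..int n}. of_bool (b (i, Some k)) * 2 powi k)
        = (\<Sum>k\<in>{- int n..int n}. of_bool (c (i, Some k)) * 2 powi k :: real)"
      using that i by (intro sum.cong refl arg_cong2[of _ _ _ _ times] arg_cong[of _ _ of_bool]) auto
    ultimately show "truncation n b i = truncation n c i" by (simp add: truncation_def)
  qed
  show "integrable \<mu> (\<lambda>b. h (truncation n b))"
    "(\<integral>b. h (truncation n b) \<partial>\<mu>) = \<Lambda> (\<lambda>x. h (truncation n (digits x)))"
    using simple_integral[OF F, of "\<lambda>b. h (truncation n b)"] eq by blast+
qed

section \<open>Measurability, convergence and moments of realized points\<close>

lemma truncation_measurable [measurable]: "(\<lambda>b. truncation n b i) \<in> borel_measurable \<mu>"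
  using truncation_integral(1)[of "{i}" "\<lambda>x. x i"] by auto

lemma realize_measurable [measurable]: "(\<lambda>b. realize b i) \<in> borel_measurable \<mu>"
  unfolding realize_def by (rule borel_measurable_lim_metric) simp

lemma mon_measurable [measurable]:
  "(\<lambda>b. mon m (truncation n b)) \<in> borel_measurable \<mu>" "(\<lambda>b. mon m (realize b)) \<in> borel_measurable \<mu>"
  unfolding mon_def by simp_all

lemma peval_measurable [measurable]:
  "(\<lambda>b. peval f (truncation n b)) \<in> borel_measurable \<mu>" "(\<lambda>b. peval f (realize b)) \<in> borel_measurable \<mu>"
  unfolding peval_mon by simp_all

text \<open>Truncating the digits of a point never increases a monomial in absolute value. The bound
  does not depend on n, as monotone convergence and Fatou's lemma require.\<close>

lemma mon_truncation_nn_integral: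
  assumes "Poly_Mapping.keys m \<subseteq> \<Omega>"
  shows "(\<integral>\<^sup>+b. ennreal \<bar>mon m (truncation n b)\<bar> \<partial>\<mu>) \<le> ennreal (\<Lambda> (\<lambda>x. \<bar>mon m x\<bar>))"
proof -
  have eq: "\<bar>mon m x\<bar> = \<bar>mon m y\<bar>" if "\<And>i. i \<in> Poly_Mapping.keys m \<Longrightarrow> x i = y i" for x y
    using that by (simp add: mon_def)
  have int: "integrable \<mu> (\<lambda>b. \<bar>mon m (truncation n b)\<bar>)"
    "(\<integral>b. \<bar>mon m (truncation n b)\<bar> \<partial>\<mu>) = \<Lambda> (\<lambda>x. \<bar>mon m (truncation n (digits x))\<bar>)"
    using truncation_integral[OF finite_keys, of m "\<lambda>x. \<bar>mon m x\<bar>" n] eq by blast+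
  have "peval (Poly_Mapping.single m 1) = mon m"
    by (rule ext) (simp add: peval_single)
  then have "mon m \<in> poly_bounded \<Omega>"
    using peval_poly_bounded[OF single_in_poly_alg[OF assms], of 1] by simp
  then have W: "(\<lambda>x. \<bar>mon m x\<bar>) \<in> poly_bounded \<Omega>"
    by (rule poly_bounded_abs)
  have "\<bar>mon m (truncation n (digits x))\<bar> \<le> \<bar>mon m x\<bar>" for x
    by (intro mon_mono truncation_digits)
  then have "\<Lambda> (\<lambda>x. \<bar>mon m (truncation n (digits x))\<bar>) \<le> \<Lambda> (\<lambda>x. \<bar>mon m x\<bar>)"
    by (intro mono W poly_bounded_mono[OF W]) auto
  moreover have "(\<integral>\<^sup>+b. ennreal \<bar>mon m (truncation n b)\<bar> \<partial>\<mu>) = ennreal (\<integral>b. \<bar>mon m (truncation n b)\<bar> \<partial>\<mu>)"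
    by (rule nn_integral_eq_integral) (use int(1) in auto)
  ultimately show ?thesis unfolding int(2) by (simp add: ennreal_leI)
qed

text \<open>The first absolute moments of the truncations are bounded uniformly, so by monotone
  convergence their supremum has finite integral and is finite almost everywhere. No mass escapes to
  infinity.\<close>

lemma AE_truncation_convergent:
  assumes "i \<in> \<Omega>"
  shows "AE b in \<mu>. convergent (\<lambda>n. truncation n b i)"
proof -
  \<comment> \<open>The exponent vector of a single variable, so that the bound for monomials
    applies to a coordinate.\<close>
  define m where "m = Poly_Mapping.single i (1::nat)"
  have mon: "mon m x = x i" for x by (simp add: mon_def m_def)
  have keys: "Poly_Mapping.keys m \<subseteq> \<Omega>" using assms by (simp add: m_def)
  have inc: "incseq (\<lambda>n b. ennreal \<bar>truncation n b i\<bar>)"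
    by (auto simp: incseq_def le_fun_def intro!: ennreal_leI abs_truncation_mono)
  have "(\<integral>\<^sup>+b. (SUP n. ennreal \<bar>truncation n b i\<bar>) \<partial>\<mu>) = (SUP n. \<integral>\<^sup>+b. ennreal \<bar>truncation n b i\<bar> \<partial>\<mu>)"
    by (rule nn_integral_monotone_convergence_SUP[OF inc]) simp
  also have "\<dots> \<le> ennreal (\<Lambda> (\<lambda>x. \<bar>mon m x\<bar>))"
    using mon_truncation_nn_integral[OF keys] by (intro SUP_least) (simp add: mon)
  finally have "(\<integral>\<^sup>+b. (SUP n. ennreal \<bar>truncation n b i\<bar>) \<partial>\<mu>) \<noteq> \<infinity>"
    by (auto simp: top_unique)
  then have "AE b in \<mu>. (SUP n. ennreal \<bar>truncation n b i\<bar>) \<noteq> \<infinity>"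
    by (intro nn_integral_PInf_AE) auto
  then show ?thesis
  proof eventually_elim
    case (elim b)
    then obtain C where C: "(SUP n. ennreal \<bar>truncation n b i\<bar>) = ennreal C" "C \<ge> 0"
      by (cases "SUP n. ennreal \<bar>truncation n b i\<bar>") auto
    show ?case
    proof (rule truncation_convergent)
      fix n
      have "ennreal \<bar>truncation n b i\<bar> \<le> ennreal C" unfolding C(1)[symmetric] by (rule SUP_upper) simp
      then show "\<bar>truncation n b i\<bar> \<le> C" using C(2) by simp
    qed
  qed
qed

text \<open>Restricted to finitely many coordinates because null sets cannot be united over an
  uncountable \<open>\<Omega>\<close>; a polynomial never asks for more.\<close>

lemma AE_truncation_realize:
  assumes "finite F" "F \<subseteq> \<Omega>"
  shows "AE b in \<mu>. \<forall>i\<in>F. (\<lambda>n. truncation n b i) \<longlonglongrightarrow> realize b i \<and> (\<forall>n. \<bar>truncation n b i\<bar> \<le> \<bar>realize b i\<bar>)"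
proof (rule AE_finite_allI[OF assms(1)])
  fix i assume "i \<in> F"
  then have "AE b in \<mu>. convergent (\<lambda>n. truncation n b i)"
    using assms(2) AE_truncation_convergent by auto
  then show "AE b in \<mu>. (\<lambda>n. truncation n b i) \<longlonglongrightarrow> realize b i \<and> (\<forall>n. \<bar>truncation n b i\<bar> \<le> \<bar>realize b i\<bar>)"
    by eventually_elim (auto simp: realize_def convergent_LIMSEQ_iff abs_truncation_le_lim)
qed

text \<open>Fatou's lemma carries the uniform moment bound to the limit. Domination cannot serve
  here, since the natural dominating function is the one whose integrability is being shown.\<close>

lemma mon_realize_integrable:
  assumes m: "Poly_Mapping.keys m \<subseteq> \<Omega>"
  shows "integrable \<mu> (\<lambda>b. mon m (realize b))"
proof (rule integrableI_bounded)
  have "AE b in \<mu>. ennreal \<bar>mon m (realize b)\<bar> = liminf (\<lambda>n. ennreal \<bar>mon m (truncation n b)\<bar>)"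
    using AE_truncation_realize[OF finite_keys m]
  proof eventually_elim
    case (elim b)
    then have "(\<lambda>n. ennreal \<bar>mon m (truncation n b)\<bar>) \<longlonglongrightarrow> ennreal \<bar>mon m (realize b)\<bar>"
      unfolding mon_def by (intro tendsto_intros) auto
    then show ?case by (rule lim_imp_Liminf[OF sequentially_bot, symmetric])
  qed
  then have "(\<integral>\<^sup>+b. ennreal \<bar>mon m (realize b)\<bar> \<partial>\<mu>) = (\<integral>\<^sup>+b. liminf (\<lambda>n. ennreal \<bar>mon m (truncation n b)\<bar>) \<partial>\<mu>)"
    by (rule nn_integral_cong_AE)
  also have "\<dots> \<le> liminf (\<lambda>n. \<integral>\<^sup>+b. ennreal \<bar>mon m (truncation n b)\<bar> \<partial>\<mu>)"
    by (rule nn_integral_liminf) simp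
  also have "\<dots> \<le> ennreal (\<Lambda> (\<lambda>x. \<bar>mon m x\<bar>))"
    by (intro Liminf_le[OF sequentially_bot] always_eventually allI mon_truncation_nn_integral[OF m])
  also have "\<dots> < \<infinity>" by simp
  finally show "(\<integral>\<^sup>+b. ennreal (norm (mon m (realize b))) \<partial>\<mu>) < \<infinity>" by simp
qed simp

text \<open>Identity and negative part are both contractions fixing 0. Contraction transfers the
  convergence rate from f to \<psi> after f, and fixing 0 gives |\<psi> t| \<le> |t|, hence
  domination. Integral and functional agree at truncated points and then converge separately, the
  integrals by dominated convergence and the values of \<open>\<Lambda>\<close> by the rate.\<close>

lemma lipschitz_peval_integral:
  assumes f: "f \<in> poly_alg \<Omega>" and lip: "\<And>s t. \<bar>\<psi> s - \<psi> t\<bar> \<le> \<bar>s - t\<bar>" and zero: "\<psi> 0 = (0 :: real)"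
  shows "integrable \<mu> (\<lambda>b. \<psi> (peval f (realize b)))"
    "(\<integral>b. \<psi> (peval f (realize b)) \<partial>\<mu>) = \<Lambda> (\<lambda>x. \<psi> (peval f x))"
proof -
  have \<psi>_le: "\<bar>\<psi> t\<bar> \<le> \<bar>t\<bar>" for t using lip[of t 0] zero by simp
  have cont: "continuous_on UNIV \<psi>"
    using lip by (intro lipschitz_on_continuous_on[of 1] lipschitz_onI) (auto simp: dist_real_def)
  have [measurable]: "\<psi> \<in> borel_measurable borel"
    using cont by (rule borel_measurable_continuous_onI)
  define V where "V = (\<Union>m\<in>Poly_Mapping.keys f. Poly_Mapping.keys m)"
  have V: "finite V" "V \<subseteq> \<Omega>" using f by (auto simp: V_def poly_alg_def)
  have fV: "f \<in> poly_alg V" by (auto simp: V_def poly_alg_def)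
  \<comment> \<open>Truncations are monotone in absolute value, so each monomial is dominated by its
    absolute value at the realized point.\<close>
  define w where "w = (\<lambda>b. \<Sum>m\<in>Poly_Mapping.keys f. \<bar>Poly_Mapping.lookup f m\<bar> * \<bar>mon m (realize b)\<bar>)"
  have w: "integrable \<mu> w"
    unfolding w_def using f
    by (intro Bochner_Integration.integrable_sum integrable_mult_right integrable_abs mon_realize_integrable)
      (auto simp: poly_alg_def)
  have lim: "AE b in \<mu>. (\<lambda>n. \<psi> (peval f (truncation n b))) \<longlonglongrightarrow> \<psi> (peval f (realize b))"
    using AE_truncation_realize[OF V]
  proof eventually_elim
    case (elim b)
    then have "(\<lambda>n. peval f (truncation n b)) \<longlonglongrightarrow> peval f (realize b)"
      unfolding peval_def by (intro tendsto_intros) (auto simp: V_def)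
    then show ?case
      using cont by (intro continuous_on_tendsto_compose[of UNIV \<psi>]) auto
  qed
  have dom: "AE b in \<mu>. norm (\<psi> (peval f (truncation n b))) \<le> w b" for n
    using AE_truncation_realize[OF V]
  proof eventually_elim
    case (elim b)
    have "norm (\<psi> (peval f (truncation n b))) \<le> \<bar>peval f (truncation n b)\<bar>" using \<psi>_le by simp
    also have "\<dots> \<le> (\<Sum>m\<in>Poly_Mapping.keys f. \<bar>Poly_Mapping.lookup f m * mon m (truncation n b)\<bar>)"
      unfolding peval_mon by (rule sum_abs)
    also have "\<dots> \<le> w b"
      unfolding w_def abs_mult using elim
      by (intro sum_mono mult_left_mono mon_mono) (auto simp: V_def)
    finally show ?case .
  qed
  note dct = integral_dominated_convergence[OF _ _ w lim dom]
  show "integrable \<mu> (\<lambda>b. \<psi> (peval f (realize b)))"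
    by (rule integrable_dominated_convergence[OF _ _ w lim dom]) simp_all
  have "(\<lambda>n. \<integral>b. \<psi> (peval f (truncation n b)) \<partial>\<mu>) \<longlonglongrightarrow> (\<integral>b. \<psi> (peval f (realize b)) \<partial>\<mu>)"
    by (rule dct) simp_all
  moreover have "(\<integral>b. \<psi> (peval f (truncation n b)) \<partial>\<mu>) = \<Lambda> (\<lambda>x. \<psi> (peval f (truncation n (digits x))))" for n
    using peval_cong[OF fV] by (intro truncation_integral(2)[OF V(1)]) metis
  moreover have "(\<lambda>n. \<Lambda> (\<lambda>x. \<psi> (peval f (truncation n (digits x))))) \<longlonglongrightarrow> \<Lambda> (\<lambda>x. \<psi> (peval f x))"
  proof -
    obtain H where H: "H \<in> poly_bounded \<Omega>" "\<And>n x. \<bar>peval f (truncation n (digits x))\<bar> \<le> H x"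
      "\<And>n x. \<bar>peval f (truncation n (digits x)) - peval f x\<bar> \<le> H x / 2 ^ n"
      using truncation_approximable_peval[OF f] unfolding truncation_approximable_def by metis
    have W1: "(\<lambda>x. \<psi> (peval f (truncation n (digits x)))) \<in> poly_bounded \<Omega>" for n
    proof (rule poly_bounded_mono[OF H(1)])
      show "\<bar>\<psi> (peval f (truncation n (digits x)))\<bar> \<le> \<bar>H x\<bar>" for x
        using \<psi>_le[of "peval f (truncation n (digits x))"] H(2)[of n x] by linarith
    qed
    have W2: "(\<lambda>x. \<psi> (peval f x)) \<in> poly_bounded \<Omega>"
      by (rule poly_bounded_mono[OF peval_poly_bounded[OF f]]) (rule \<psi>_le)
    have bound: "\<bar>\<Lambda> (\<lambda>x. \<psi> (peval f (truncation n (digits x)))) - \<Lambda> (\<lambda>x. \<psi> (peval f x))\<bar> \<le> 1 / 2 ^ n * \<Lambda> H" for n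
    proof -
      have "\<bar>\<Lambda> (\<lambda>x. \<psi> (peval f (truncation n (digits x)))) - \<Lambda> (\<lambda>x. \<psi> (peval f x))\<bar> \<le> \<Lambda> (\<lambda>x. 1 / 2 ^ n * H x)"
      proof (rule diff_bound[OF W1 W2])
        show "(\<lambda>x. 1 / 2 ^ n * H x) \<in> poly_bounded \<Omega>"
          by (intro poly_bounded_mult poly_bounded_const H)
        show "\<bar>\<psi> (peval f (truncation n (digits x))) - \<psi> (peval f x)\<bar> \<le> 1 / 2 ^ n * H x" for x
          using order_trans[OF lip H(3)[of n x]] by simp
      qed
      then show ?thesis unfolding scale[OF H(1)] .
    qed
    have "(\<lambda>n. 1 / 2 ^ n * \<Lambda> H) \<longlonglongrightarrow> 0 * \<Lambda> H"
      using LIMSEQ_power_zero[of "1 / 2 :: real"] by (intro tendsto_mult tendsto_const) (simp add: power_one_over)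
    then have lim0: "(\<lambda>n. 1 / 2 ^ n * \<Lambda> H) \<longlonglongrightarrow> 0" by simp
    have "(\<lambda>n. \<Lambda> (\<lambda>x. \<psi> (peval f (truncation n (digits x)))) - \<Lambda> (\<lambda>x. \<psi> (peval f x))) \<longlonglongrightarrow> 0"
      by (rule Lim_null_comparison[OF always_eventually lim0]) (simp only: real_norm_def bound simp_thms)
    then show ?thesis by (rule LIM_zero_cancel)
  qed
  ultimately show "(\<integral>b. \<psi> (peval f (realize b)) \<partial>\<mu>) = \<Lambda> (\<lambda>x. \<psi> (peval f x))"
    using LIMSEQ_unique by simp
qed

lemma peval_integral:
  assumes "f \<in> poly_alg \<Omega>"
  shows "integrable \<mu> (\<lambda>b. peval f (realize b))" "(\<integral>b. peval f (realize b) \<partial>\<mu>) = \<Lambda> (peval f)"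
  using lipschitz_peval_integral[OF assms, of "\<lambda>t. t"] by simp_all

text \<open>Agreement on polynomials would only make the integral of f nonnegative. The negative
  part of f is in general no polynomial, yet it lies in the domain of \<open>\<Lambda>\<close> and
  vanishes on \<open>Y\<close>, so its integral is zero.\<close>

lemma AE_peval_nonneg:
  assumes f: "f \<in> poly_alg \<Omega>" and nonneg: "\<And>x. x \<in> Y \<Longrightarrow> 0 \<le> peval f x"
  shows "AE b in \<mu>. 0 \<le> peval f (realize b)"
proof -
  let ?\<psi> = "\<lambda>t :: real. max 0 (- t)"
  have lip: "\<bar>?\<psi> s - ?\<psi> t\<bar> \<le> \<bar>s - t\<bar>" for s t by (auto simp: max_def)
  note int = lipschitz_peval_integral[OF f lip]
  have "(\<lambda>x. ?\<psi> (peval f x)) \<in> poly_bounded \<Omega>"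
    by (rule poly_bounded_mono[OF peval_poly_bounded[OF f]]) auto
  then have "\<Lambda> (\<lambda>x. ?\<psi> (peval f x)) = 0" using nonneg by (intro vanish) (simp_all add: max_absorb1)
  then have "(\<integral>b. ?\<psi> (peval f (realize b)) \<partial>\<mu>) = 0" using int(2) by simp
  then have "AE b in \<mu>. ?\<psi> (peval f (realize b)) = 0"
    using int(1) by (subst (asm) integral_nonneg_eq_0_iff_AE) auto
  then show ?thesis by eventually_elim (simp add: max_def split: if_splits)
qed

end

lemma (in positive_functional) digit_measure_exists:
  obtains \<mu> where "digit_measure \<Omega> Y \<Lambda> \<mu>"
proof -
  let ?m = "\<lambda>A. \<Lambda> (\<lambda>x. indicator A (digits x))"
  have nonneg: "0 \<le> ?m A" for A by (intro pos indicator_poly_bounded) simp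
  have add: "?m (A \<union> B) = ?m A + ?m B" if "A \<inter> B = {}" for A B
    unfolding indicator_add[OF that, symmetric] by (intro add indicator_poly_bounded)
  obtain \<mu> :: "('i \<times> int option \<Rightarrow> bool) measure" where
    "sets \<mu> = sigma_sets UNIV cylinders" "finite_measure \<mu>"
    "\<And>A. A \<in> cylinders \<Longrightarrow> measure \<mu> A = ?m A"
    using cylinder_measure_exists[of ?m, OF nonneg add] by blast
  then have "digit_measure \<Omega> Y \<Lambda> \<mu>"
    by (intro digit_measure.intro digit_measure_axioms.intro positive_functional_axioms)
  then show ?thesis by (rule that)
qed

section \<open>Finite measures on character spaces\<close>

lemma subalgebra_hull: "subalgebra (subalgebra hull C)"
proof (rule hull_in)
  fix T :: "'a set set" assume T: "\<forall>t\<in>T. subalgebra t"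
  then show "subalgebra (\<Inter> T)"
    by (auto simp: subalgebra_def subspace_def)
qed

lemma subalgebra_scaleR: "subalgebra D \<Longrightarrow> a \<in> D \<Longrightarrow> c *\<^sub>R a \<in> D"
  by (simp add: subalgebra_def subspace_scale)

lemma char_add: "\<alpha> \<in> char_space D \<Longrightarrow> a \<in> D \<Longrightarrow> b \<in> D \<Longrightarrow> \<alpha> (a + b) = \<alpha> a + \<alpha> b"
  and char_mult: "\<alpha> \<in> char_space D \<Longrightarrow> a \<in> D \<Longrightarrow> b \<in> D \<Longrightarrow> \<alpha> (a * b) = \<alpha> a * \<alpha> b"
  and char_one: "\<alpha> \<in> char_space D \<Longrightarrow> \<alpha> 1 = 1"
  by (auto simp: char_space_def)

text \<open>A unital ring endomorphism of the reals preserves squares, hence the order, and is therefore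
  the identity. So characters are automatically linear over the reals.\<close>

lemma real_ring_endomorphism_id:
  fixes \<phi> :: "real \<Rightarrow> real"
  assumes add: "\<And>a b. \<phi> (a + b) = \<phi> a + \<phi> b" and mult: "\<And>a b. \<phi> (a * b) = \<phi> a * \<phi> b"
    and one: "\<phi> 1 = 1"
  shows "\<phi> c = c"
proof -
  interpret additive \<phi> by standard (rule add)
  have nat: "\<phi> (of_nat n) = of_nat n" for n
    by (induction n) (auto simp: zero add one)
  have int: "\<phi> (of_int k) = of_int k" for k
    by (cases k rule: int_cases2) (auto simp: nat minus)
  have rat: "\<phi> r = r" if "r \<in> \<rat>" for r
  proof -
    obtain a b where b: "b > 0" and r: "r = of_int a / of_int b"
      using \<open>r \<in> \<rat>\<close> by (rule Rats_cases')
    then have "\<phi> (of_int a) = \<phi> r * \<phi> (of_int b)" by (simp flip: mult)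
    then have "\<phi> r = of_int a / of_int b" unfolding int using b by (simp add: field_simps)
    then show ?thesis using r by simp
  qed
  have mono: "\<phi> a \<le> \<phi> b" if "a \<le> b" for a b
  proof -
    have "\<phi> (b - a) = \<phi> (sqrt (b - a)) * \<phi> (sqrt (b - a))"
      using that by (simp flip: mult)
    then have "0 \<le> \<phi> (b - a)" by simp
    then show ?thesis by (simp add: diff)
  qed
  show ?thesis
  proof (rule ccontr)
    assume "\<phi> c \<noteq> c"
    then consider "\<phi> c < c" | "c < \<phi> c" by linarith
    then show False
    proof cases
      case 1
      then obtain q where "q \<in> \<rat>" "\<phi> c < q" "q < c" using Rats_dense_in_real by blast
      then show False using mono[of q c] rat by auto
    next
      case 2
      then obtain q where "q \<in> \<rat>" "c < q" "q < \<phi> c" using Rats_dense_in_real by blast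
      then show False using mono[of c q] rat by auto
    qed
  qed
qed

lemma char_scaleR:
  assumes D: "subalgebra D" and \<alpha>: "\<alpha> \<in> char_space D" and a: "a \<in> D"
  shows "\<alpha> (c *\<^sub>R a) = c * \<alpha> a"
proof -
  have one: "r *\<^sub>R 1 \<in> D" for r :: real
    using D by (simp add: subalgebra_def subspace_scale)
  \<comment> \<open>On multiples of the unit a character is a unital ring endomorphism of the
    reals.\<close>
  have "\<alpha> (r *\<^sub>R 1) = r" for r
  proof (rule real_ring_endomorphism_id)
    show "\<alpha> ((r + s) *\<^sub>R 1) = \<alpha> (r *\<^sub>R 1) + \<alpha> (s *\<^sub>R 1)" for r s
      using char_add[OF \<alpha> one one] by (simp add: scaleR_add_left)
    show "\<alpha> ((r * s) *\<^sub>R 1) = \<alpha> (r *\<^sub>R 1) * \<alpha> (s *\<^sub>R 1)" for r s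
      using char_mult[OF \<alpha> one[of r] one[of s]] by (simp add: mult.commute[of r s])
  qed (simp add: char_one[OF \<alpha>])
  then show ?thesis
    using char_mult[OF \<alpha> one[of c] a] by simp
qed

lemma restrict_char_space:
  assumes "\<alpha> \<in> char_space D" "D' \<subseteq> D" "subalgebra D'"
  shows "restrict \<alpha> D' \<in> char_space D'"
  using assms unfolding char_space_def subalgebra_def subspace_def
  by (auto simp: subset_iff)

lemma topspace_char_topology:
  assumes "subalgebra D"
  shows "topspace (char_topology D) = char_space D"
proof -
  have "1 \<in> D" using assms by (simp add: subalgebra_def)
  then show ?thesis
    unfolding char_topology_def topology_generated_by_topspace
    by (auto intro!: exI[of _ "1"] exI[of _ UNIV])
qed

lemma continuous_map_char_eval:
  assumes "subalgebra D" "d \<in> D"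
  shows "continuous_map (char_topology D) euclideanreal (\<lambda>\<alpha>. \<alpha> d)"
  unfolding continuous_map_def
proof (intro conjI allI impI)
  fix U :: "real set" assume "openin euclidean U"
  then have "openin (char_topology D) {\<alpha> \<in> char_space D. \<alpha> d \<in> U}"
    using assms(2) unfolding char_topology_def by (intro topology_generated_by_Basis) auto
  then show "openin (char_topology D) {\<alpha> \<in> topspace (char_topology D). \<alpha> d \<in> U}"
    using assms(1) by (simp add: topspace_char_topology)
qed auto

text \<open>Generators are listed by natural numbers, repetitions allowed, so that evaluation at
  them maps characters into a countable power of the real line, which is a Polish space.\<close>

locale generated_subalgebra =
  fixes c :: "nat \<Rightarrow> 'a::{comm_ring_1, real_algebra_1}" and D :: "'a set"
  assumes D: "D = subalgebra hull (range c)"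
begin

definition coords :: "('a \<Rightarrow> real) \<Rightarrow> nat \<Rightarrow> real" where
  "coords \<alpha> = (\<lambda>n. \<alpha> (c n))"

lemma sub: "subalgebra D"
  unfolding D by (rule subalgebra_hull)

lemma gen: "c n \<in> D"
  unfolding D by (meson hull_subset rangeI subset_eq)

text \<open>Zero has no case of its own because it is the scalar multiple 0 of the unit.\<close>

lemma induct [consumes 1, case_names gen one add mult scale]:
  assumes "d \<in> D" "\<And>n. P (c n)" "P 1"
    "\<And>a b. a \<in> D \<Longrightarrow> b \<in> D \<Longrightarrow> P a \<Longrightarrow> P b \<Longrightarrow> P (a + b)"
    "\<And>a b. a \<in> D \<Longrightarrow> b \<in> D \<Longrightarrow> P a \<Longrightarrow> P b \<Longrightarrow> P (a * b)"
    "\<And>r a. a \<in> D \<Longrightarrow> P a \<Longrightarrow> P (r *\<^sub>R a)"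
  shows "P d"
proof -
  have 0: "P 0" using assms(6)[of 1 0] assms(3) sub by (simp add: subalgebra_def)
  have "D \<subseteq> {d \<in> D. P d}"
    unfolding D
  proof (rule hull_minimal)
    show "range c \<subseteq> {d \<in> subalgebra hull range c. P d}"
      using gen assms(2) unfolding D by auto
    have "subalgebra {d \<in> D. P d}"
      using sub assms(3-6) 0 by (auto simp: subalgebra_def subspace_def)
    then show "subalgebra {d \<in> subalgebra hull range c. P d}" by (simp add: D)
  qed
  then show ?thesis using assms(1) by auto
qed

lemma continuous_map_coords: "continuous_map (char_topology D) euclidean coords"
  unfolding euclidean_product_topology[symmetric] continuous_map_componentwise_UNIV coords_def
  using sub gen by (simp add: continuous_map_char_eval)

text \<open>Evaluation at any element of \<open>D\<close> arises by algebra operations from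
  evaluations at generators, so it is continuous as soon as those are. Open sets thereby become
  preimages under \<open>coords\<close>.\<close>

lemma char_topology_eq: "char_topology D = pullback_topology (char_space D) coords euclidean"
proof -
  let ?T = "pullback_topology (char_space D) coords euclidean"
  have top: "topspace ?T = char_space D" by (simp add: topspace_pullback_topology)
  have cont: "continuous_map ?T euclideanreal (\<lambda>\<alpha>. \<alpha> d)" if "d \<in> D" for d
    using that
  proof (induction rule: induct)
    case (gen n)
    have "continuous_map ?T euclidean coords"
      using continuous_map_pullback[of euclidean euclidean id] by simp
    then show ?case
      unfolding euclidean_product_topology[symmetric] continuous_map_componentwise_UNIV coords_def by simp
  next
    case one
    have "continuous_map ?T euclideanreal (\<lambda>\<alpha>. 1)" by simp
    then show ?case by (rule continuous_map_eq) (auto simp: top char_one)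
  next
    case (add a b)
    then have "continuous_map ?T euclideanreal (\<lambda>\<alpha>. \<alpha> a + \<alpha> b)" by (intro continuous_map_add)
    then show ?case by (rule continuous_map_eq) (use add in \<open>auto simp: top char_add\<close>)
  next
    case (mult a b)
    then have "continuous_map ?T euclideanreal (\<lambda>\<alpha>. \<alpha> a * \<alpha> b)" by (intro continuous_map_real_mult)
    then show ?case by (rule continuous_map_eq) (use mult in \<open>auto simp: top char_mult\<close>)
  next
    case (scale r a)
    then have "continuous_map ?T euclideanreal (\<lambda>\<alpha>. r * \<alpha> a)" by (intro continuous_map_real_mult_left)
    then show ?case by (rule continuous_map_eq) (use scale in \<open>auto simp: top char_scaleR[OF sub]\<close>)
  qed
  show ?thesis
    unfolding topology_eq
  proof (intro allI iffI)
    fix V assume "openin (char_topology D) V"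
    then have "generate_topology_on {{\<alpha> \<in> char_space D. \<alpha> a \<in> U} |a U. a \<in> D \<and> open U} V"
      by (simp add: char_topology_def openin_topology_generated_by)
    then show "openin ?T V"
    proof (induction rule: generate_topology_on.induct)
      case (Basis s)
      then obtain a U where s: "s = {\<alpha> \<in> char_space D. \<alpha> a \<in> U}" "a \<in> D" "open U" by auto
      show ?case
        using openin_continuous_map_preimage[OF cont[OF s(2)], of U] s by (simp add: top)
    qed auto
  next
    fix V assume "openin ?T V"
    then obtain U where U: "open U" "V = coords -` U \<inter> char_space D"
      by (auto simp: openin_pullback_topology)
    then show "openin (char_topology D) V"
      using openin_continuous_map_preimage[OF continuous_map_coords, of U]
      by (simp add: topspace_char_topology[OF sub] vimage_def Int_def conj_commute)
  qed
qed

text \<open>Convergence at the generators spreads to all of \<open>D\<close> through the algebra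
  operations, and a pointwise limit of characters is a character. Sequences suffice because the
  target is metrizable.\<close>

lemma closed_coords_range: "closed (coords ` char_space D)"
  unfolding closed_sequential_limits
proof (intro allI impI, elim conjE)
  fix X :: "nat \<Rightarrow> nat \<Rightarrow> real" and l
  assume X: "\<forall>n. X n \<in> coords ` char_space D" and lim: "X \<longlonglongrightarrow> l"
  then have "\<forall>n. \<exists>\<alpha>. \<alpha> \<in> char_space D \<and> X n = coords \<alpha>" by auto
  then obtain \<alpha> where \<alpha>: "\<And>n. \<alpha> n \<in> char_space D" "\<And>n. X n = coords (\<alpha> n)" by metis
  have limc: "(\<lambda>n. \<alpha> n (c k)) \<longlonglongrightarrow> l k" for k
  proof -
    have "isCont (\<lambda>f :: nat \<Rightarrow> real. f k) l"
      by (metis continuous_on_product_coordinates continuous_on_eq_continuous_at open_UNIV UNIV_I)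
    then have "(\<lambda>n. X n k) \<longlonglongrightarrow> l k"
      using lim by (rule isCont_tendsto_compose)
    then show ?thesis by (simp add: \<alpha>(2) coords_def)
  qed
  have conv: "convergent (\<lambda>n. \<alpha> n d)" if "d \<in> D" for d
    using that
  proof (induction rule: induct)
    case (gen k)
    then show ?case using limc by (auto simp: convergent_def)
  next
    case one
    then show ?case by (simp add: char_one[OF \<alpha>(1)] convergent_const)
  next
    case (add a b)
    then show ?case by (simp add: char_add[OF \<alpha>(1)] convergent_add)
  next
    case (mult a b)
    then show ?case by (simp add: char_mult[OF \<alpha>(1)] convergent_mult)
  next
    case (scale r a)
    then show ?case by (simp add: char_scaleR[OF sub \<alpha>(1)] convergent_mult convergent_const)
  qed
  define \<beta> where "\<beta> = (\<lambda>d\<in>D. lim (\<lambda>n. \<alpha> n d))"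
  have \<beta>: "(\<lambda>n. \<alpha> n d) \<longlonglongrightarrow> \<beta> d" if "d \<in> D" for d
    using conv[OF that] that by (simp add: \<beta>_def convergent_LIMSEQ_iff)
  have "\<beta> \<in> char_space D"
    unfolding char_space_def
  proof (intro CollectI conjI ballI)
    show "\<beta> \<in> extensional D" by (simp add: \<beta>_def)
    have "1 \<in> D" using sub by (simp add: subalgebra_def)
    then have "(\<lambda>n. \<alpha> n 1) \<longlonglongrightarrow> \<beta> 1" by (rule \<beta>)
    then show "\<beta> 1 = 1" by (simp add: char_one[OF \<alpha>(1)] LIMSEQ_const_iff)
    fix a b assume ab: "a \<in> D" "b \<in> D"
    have "(\<lambda>n. \<alpha> n (a + b)) \<longlonglongrightarrow> \<beta> (a + b)" "(\<lambda>n. \<alpha> n (a * b)) \<longlonglongrightarrow> \<beta> (a * b)"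
      using ab sub by (auto intro!: \<beta> simp: subalgebra_def subspace_add)
    moreover have "(\<lambda>n. \<alpha> n a + \<alpha> n b) \<longlonglongrightarrow> \<beta> a + \<beta> b" "(\<lambda>n. \<alpha> n a * \<alpha> n b) \<longlonglongrightarrow> \<beta> a * \<beta> b"
      using ab by (auto intro!: tendsto_intros \<beta>)
    ultimately show "\<beta> (a + b) = \<beta> a + \<beta> b" "\<beta> (a * b) = \<beta> a * \<beta> b"
      unfolding char_add[OF \<alpha>(1) ab] char_mult[OF \<alpha>(1) ab] by (auto intro: LIMSEQ_unique)
  qed
  moreover have "coords \<beta> = l"
    using LIMSEQ_unique[OF \<beta>[OF gen] limc] by (auto simp: coords_def)
  ultimately show "l \<in> coords ` char_space D" by auto
qed

text \<open>Open sets are preimages, so a cover of the preimage descends to a cover of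
  \<open>K\<close>; containment in the range ensures that every point of \<open>K\<close> comes from
  a covered character.\<close>

lemma compactin_coords_vimage:
  assumes "compact K" "K \<subseteq> coords ` char_space D"
  shows "compactin (char_topology D) (coords -` K \<inter> char_space D)"
  unfolding compactin_def topspace_char_topology[OF sub]
proof (intro conjI allI impI)
  fix \<U> assume U: "Ball \<U> (openin (char_topology D)) \<and> coords -` K \<inter> char_space D \<subseteq> \<Union> \<U>"
  have "\<exists>G. open G \<and> V = coords -` G \<inter> char_space D" if "V \<in> \<U>" for V
    using U that by (auto simp: char_topology_eq openin_pullback_topology)
  then obtain G where G: "\<And>V. V \<in> \<U> \<Longrightarrow> open (G V)" "\<And>V. V \<in> \<U> \<Longrightarrow> V = coords -` G V \<inter> char_space D"
    by metis
  have KG: "K \<subseteq> (\<Union>V\<in>\<U>. G V)"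
  proof
    fix y assume y: "y \<in> K"
    then obtain \<alpha> where \<alpha>: "\<alpha> \<in> char_space D" "y = coords \<alpha>" using assms(2) by auto
    then obtain V where "V \<in> \<U>" "\<alpha> \<in> V" using U y by blast
    then show "y \<in> (\<Union>V\<in>\<U>. G V)" using G(2) \<alpha> by auto
  qed
  obtain F where F: "F \<subseteq> \<U>" "finite F" "K \<subseteq> (\<Union>V\<in>F. G V)"
  proof (rule compactE_image[OF assms(1) _ KG])
    show "open (G V)" if "V \<in> \<U>" for V using that by (rule G(1))
  qed (rule that)
  have "coords -` K \<inter> char_space D \<subseteq> \<Union> F"
  proof
    fix \<alpha> assume \<alpha>: "\<alpha> \<in> coords -` K \<inter> char_space D"
    then obtain V where "V \<in> F" "coords \<alpha> \<in> G V" using F(3) by auto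
    then show "\<alpha> \<in> \<Union> F" using \<alpha> F(1) G(2) by blast
  qed
  then show "\<exists>\<F>. finite \<F> \<and> \<F> \<subseteq> \<U> \<and> coords -` K \<inter> char_space D \<subseteq> \<Union> \<F>"
    using F by auto
qed auto

lemma borel_char_topology:
  "space (borel_of_topology (char_topology D)) = char_space D"
  "sets (borel_of_topology (char_topology D)) = sets (vimage_algebra (char_space D) coords borel)"
proof -
  show "space (borel_of_topology (char_topology D)) = char_space D"
    by (simp add: borel_of_topology_def topspace_char_topology[OF sub] space_measure_of_conv)
  have "vimage_algebra (char_space D) coords borel
      = sigma (char_space D) {coords -` A \<inter> char_space D |A. A \<in> Collect open}"
    unfolding borel_def by (rule vimage_algebra_sigma) auto
  moreover have "{coords -` A \<inter> char_space D |A. A \<in> Collect open} = {U. openin (char_topology D) U}"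
    unfolding char_topology_eq openin_pullback_topology by auto
  ultimately show "sets (borel_of_topology (char_topology D)) = sets (vimage_algebra (char_space D) coords borel)"
    by (simp add: borel_of_topology_def topspace_char_topology[OF sub])
qed

lemma radon_measure_char_topology:
  assumes sets: "sets \<mu> = sets (borel_of_topology (char_topology D))" and fin: "finite_measure \<mu>"
  shows "radon_measure (char_topology D) \<mu>"
proof -
  interpret finite_measure \<mu> by fact
  have space: "space \<mu> = char_space D"
    using sets_eq_imp_space_eq[OF sets] borel_char_topology(1) by simp
  have sets': "sets \<mu> = sets (vimage_algebra (char_space D) coords borel)"
    using sets borel_char_topology(2) by simp
  have meas [measurable]: "coords \<in> borel_measurable \<mu>"
    using measurable_vimage_algebra1[of coords "char_space D" borel] sets'
    by (subst measurable_cong_sets[OF sets' refl]) auto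
  define M where "M = distr \<mu> borel coords"
  have M: "emeasure M A = emeasure \<mu> (coords -` A \<inter> char_space D)" if "A \<in> sets borel" for A
    using that meas by (simp add: M_def emeasure_distr space)
  have clR: "coords ` char_space D \<in> sets borel" using closed_coords_range by (rule borel_closed)
  show ?thesis
    unfolding radon_measure_def
  proof (intro conjI ballI)
    show "sets \<mu> = sets (borel_of_topology (char_topology D))" by fact
    show "\<exists>U. openin (char_topology D) U \<and> \<alpha> \<in> U \<and> emeasure \<mu> U < \<infinity>" if "\<alpha> \<in> topspace (char_topology D)" for \<alpha>
      using that by (intro exI[of _ "topspace (char_topology D)"]) (auto simp: less_top[symmetric])
    fix E assume E: "E \<in> sets \<mu>"
    then obtain B where B: "B \<in> sets borel" "E = coords -` B \<inter> char_space D"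
      unfolding sets' by (auto simp: sets_vimage_algebra2)
    \<comment> \<open>Cutting down to the closed range does not change \<open>E\<close> and forces
      the approximating compact sets into the range, where they pull back to compact sets.\<close>
    define B' where "B' = B \<inter> coords ` char_space D"
    have B': "B' \<in> sets borel" "E = coords -` B' \<inter> char_space D" "B' \<subseteq> coords ` char_space D"
      using B clR by (auto simp: B'_def)
    have "emeasure \<mu> E = emeasure M B'" using M B' by simp
    also have "\<dots> = (SUP K\<in>{K. K \<subseteq> B' \<and> compact K}. emeasure M K)"
      using B'(1) emeasure_finite by (intro inner_regular) (auto simp: M_def emeasure_distr)
    also have "\<dots> \<le> (SUP K\<in>{K. compactin (char_topology D) K \<and> K \<subseteq> E}. emeasure \<mu> K)"
    proof (rule SUP_least)
      fix K assume K: "K \<in> {K. K \<subseteq> B' \<and> compact K}"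
      then have "emeasure M K = emeasure \<mu> (coords -` K \<inter> char_space D)"
        by (intro M borel_compact) auto
      also have "\<dots> \<le> (SUP K\<in>{K. compactin (char_topology D) K \<and> K \<subseteq> E}. emeasure \<mu> K)"
        using K B' by (intro SUP_upper CollectI conjI compactin_coords_vimage) auto
      finally show "emeasure M K \<le> (SUP K\<in>{K. compactin (char_topology D) K \<and> K \<subseteq> E}. emeasure \<mu> K)" .
    qed
    finally have "emeasure \<mu> E \<le> (SUP K\<in>{K. compactin (char_topology D) K \<and> K \<subseteq> E}. emeasure \<mu> K)" .
    moreover have "(SUP K\<in>{K. compactin (char_topology D) K \<and> K \<subseteq> E}. emeasure \<mu> K) \<le> emeasure \<mu> E"
      using E by (intro SUP_least emeasure_mono) auto
    ultimately show "emeasure \<mu> E = (SUP K\<in>{K. compactin (char_topology D) K \<and> K \<subseteq> E}. emeasure \<mu> K)"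
      by (rule antisym)
  qed
qed

end

section \<open>Restriction to countably generated subalgebras\<close>

lemma space_constr_borel: "space (constr_borel D) = char_space D"
  by (simp add: constr_borel_def space_measure_of_conv)

lemma finite_measure_constr_radon:
  assumes sets: "sets \<mu> = sets (constr_borel D)" and fin: "finite_measure \<mu>"
  shows "constr_radon D \<mu>"
  unfolding constr_radon_def
proof (intro conjI allI impI sets; elim conjE)
  fix D' assume D': "D' \<subseteq> D" "countably_generated_subalgebra D'"
  interpret finite_measure \<mu> by fact
  obtain C where C: "countable C" "D' = subalgebra hull C"
    using D'(2) by (auto simp: countably_generated_subalgebra_def)
  \<comment> \<open>An enumeration by natural numbers needs a nonempty set; inserting the unit
    ensures this without changing the hull.\<close>
  define c where "c = from_nat_into (insert 1 C)"
  have "range c = insert 1 C" using C(1) by (simp add: c_def range_from_nat_into)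
  moreover have "subalgebra hull (insert 1 C) = subalgebra hull C"
  proof (rule hull_redundant)
    show "1 \<in> subalgebra hull C" using subalgebra_hull[of C] by (simp add: subalgebra_def)
  qed
  ultimately interpret generated_subalgebra c D'
    by unfold_locales (simp add: C)
  have space: "space \<mu> = char_space D"
    using sets_eq_imp_space_eq[OF sets] by (simp add: space_constr_borel)
  have eval: "(\<lambda>\<alpha>. \<alpha> d) \<in> borel_measurable \<mu>" if d: "d \<in> D'" for d
    unfolding borel_measurable_iff_greater
  proof
    fix r :: real
    \<comment> \<open>The generating sets have threshold 0 only; adding a multiple of the unit moves
      the threshold r to 0.\<close>
    define e where "e = (- r) *\<^sub>R (1 :: 'a)"
    have one: "1 \<in> D'" using sub by (simp add: subalgebra_def)
    have e: "e \<in> D'" unfolding e_def using sub one by (rule subalgebra_scaleR)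
    have de: "d + e \<in> D'" using d e sub by (simp add: subalgebra_def subspace_add)
    have shift: "\<alpha> (d + e) = \<alpha> d - r" if "\<alpha> \<in> char_space D" for \<alpha>
    proof -
      have "restrict \<alpha> D' \<in> char_space D'" using that D'(1) sub by (rule restrict_char_space)
      then show ?thesis
        using char_add[of "restrict \<alpha> D'" D' d e] char_scaleR[OF sub, of "restrict \<alpha> D'" 1 "- r", folded e_def]
          char_one[of "restrict \<alpha> D'" D'] d one e de by simp
    qed
    then have "{\<alpha> \<in> space \<mu>. r < \<alpha> d} = {\<alpha> \<in> char_space D. \<alpha> (d + e) > 0}"
      unfolding space
    proof (intro Collect_cong conj_cong refl)
      fix \<alpha> assume "\<alpha> \<in> char_space D"
      from shift[OF this] show "r < \<alpha> d \<longleftrightarrow> 0 < \<alpha> (d + e)" by linarith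
    qed
    also have "\<dots> \<in> sets \<mu>"
      unfolding sets constr_borel_def using de D'(1) by (auto intro: in_measure_of)
    finally show "{\<alpha> \<in> space \<mu>. r < \<alpha> d} \<in> sets \<mu>" .
  qed
  have "(\<lambda>\<alpha>. restrict \<alpha> D') \<in> measurable \<mu> (vimage_algebra (char_space D') coords borel)"
  proof (rule measurable_vimage_algebra2)
    show "(\<lambda>\<alpha>. restrict \<alpha> D') \<in> space \<mu> \<rightarrow> char_space D'"
      using D'(1) sub by (auto simp: space intro: restrict_char_space)
    show "(\<lambda>\<alpha>. coords (restrict \<alpha> D')) \<in> borel_measurable \<mu>"
      using gen eval by (intro measurable_coordinatewise_then_product) (simp add: coords_def)
  qed
  then show meas: "(\<lambda>\<alpha>. restrict \<alpha> D') \<in> measurable \<mu> (borel_of_topology (char_topology D'))"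
    by (subst measurable_cong_sets[OF refl borel_char_topology(2)])
  show "radon_measure (char_topology D')
      (distr \<mu> (borel_of_topology (char_topology D')) (\<lambda>\<alpha>. restrict \<alpha> D'))"
    using finite_measure_distr[OF meas] by (intro radon_measure_char_topology) auto
qed

section \<open>Countable presentations and cylinders\<close>

lemma continuous_map_peval:
  assumes "f \<in> poly_alg \<Omega>"
  shows "continuous_map (real_power \<Omega>) euclideanreal (peval f)"
  unfolding peval_def
proof (intro continuous_map_sum continuous_map_real_mult continuous_map_prod continuous_map_real_pow)
  show "finite (Poly_Mapping.keys f)" by simp
  fix m assume m: "m \<in> Poly_Mapping.keys f"
  show "finite (Poly_Mapping.keys m)" by simp
  show "continuous_map (real_power \<Omega>) euclideanreal (\<lambda>x. Poly_Mapping.lookup f m)" by simp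
  fix i assume "i \<in> Poly_Mapping.keys m"
  then have "i \<in> \<Omega>" using m assms by (auto simp: poly_alg_def)
  then show "continuous_map (real_power \<Omega>) euclideanreal (\<lambda>x. x i)"
    by (rule continuous_map_product_projection)
qed

text \<open>Countably many polynomials involve countably many variables, and polynomial inequalities
  in those variables cut out a closed set.\<close>

lemma countably_presented_imp_cylinder:
  assumes "countably_presented \<Omega> Y"
  shows "countable_cylinder \<Omega> Y"
proof -
  obtain S where S: "S \<subseteq> poly_alg \<Omega>" "countable S"
    "Y = {\<alpha> \<in> topspace (real_power \<Omega>). \<forall>g\<in>S. 0 \<le> peval g \<alpha>}"
    using assms by (auto simp: countably_presented_def)
  define I where "I = (\<Union>g\<in>S. \<Union>m\<in>Poly_Mapping.keys g. Poly_Mapping.keys m)"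
  have I: "I \<subseteq> \<Omega>" "countable I"
    using S(1) unfolding I_def
    by (auto simp: poly_alg_def) (intro countable_UN S(2) countable_finite finite_keys)
  have SI: "g \<in> poly_alg I" if "g \<in> S" for g
    using that by (auto simp: poly_alg_def I_def)
  let ?Y = "{\<beta> \<in> topspace (real_power I). \<forall>g\<in>S. 0 \<le> peval g \<beta>}"
  have "closedin (real_power I) {\<beta> \<in> topspace (real_power I). peval g \<beta> \<in> {0..}}" if "g \<in> S" for g
    by (rule closedin_continuous_map_preimage[OF continuous_map_peval[OF SI[OF that]]]) simp
  \<comment> \<open>The extra factor covers empty \<open>S\<close>, whose bare intersection would be
    the whole type rather than the space of extensional points.\<close>
  then have "closedin (real_power I)
      (topspace (real_power I) \<inter> (\<Inter>g\<in>S. {\<beta> \<in> topspace (real_power I). peval g \<beta> \<in> {0..}}))"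
    by (cases "S = {}")
      (simp_all only: INT_empty Int_UNIV_right closedin_topspace closedin_Int closedin_INT not_False_eq_True)
  also have "topspace (real_power I) \<inter> (\<Inter>g\<in>S. {\<beta> \<in> topspace (real_power I). peval g \<beta> \<in> {0..}}) = ?Y"
    by auto
  finally have "closedin (real_power I) ?Y" .
  moreover have "Y = {\<alpha> \<in> topspace (real_power \<Omega>). restrict \<alpha> I \<in> ?Y}"
  proof -
    have "peval g (restrict \<alpha> I) = peval g \<alpha>" if "g \<in> S" for g \<alpha>
      using SI[OF that] by (rule peval_cong) simp
    then show ?thesis by (auto simp: S(3))
  qed
  ultimately show ?thesis
    unfolding countable_cylinder_def using I by (intro exI[of _ I] exI[of _ ?Y]) simp
qed

text \<open>For distinct listed indices this is negative exactly in the open ball with the given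
  rational centre and squared radius \<open>r\<close>. Rational data make the family countable over
  a countable index set.\<close>

definition ball_poly :: "('i \<times> rat) list \<Rightarrow> rat \<Rightarrow> 'i mpolynomial" where
  "ball_poly qs r = (\<Sum>(i, q)\<leftarrow>qs. (pvar i - of_rat q *\<^sub>R 1) * (pvar i - of_rat q *\<^sub>R 1)) - of_rat r *\<^sub>R 1"

lemma ball_poly_in_poly_alg:
  assumes "fst ` set qs \<subseteq> \<Omega>"
  shows "ball_poly qs r \<in> poly_alg \<Omega>"
proof -
  have "(\<Sum>(i, q)\<leftarrow>qs. (pvar i - of_rat q *\<^sub>R 1) * (pvar i - of_rat q *\<^sub>R 1)) \<in> poly_alg \<Omega>"
    using assms
    by (induction qs) (auto intro!: zero_in_poly_alg add_in_poly_alg mult_in_poly_alg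
        diff_in_poly_alg pvar_in_poly_alg scaleR_in_poly_alg one_in_poly_alg)
  then show ?thesis
    unfolding ball_poly_def by (intro diff_in_poly_alg scaleR_in_poly_alg one_in_poly_alg)
qed

lemma peval_ball_poly:
  "peval (ball_poly qs r) x = (\<Sum>(i, q)\<leftarrow>qs. (x i - of_rat q)\<^sup>2) - of_rat r"
proof -
  have "peval (\<Sum>(i, q)\<leftarrow>qs. (pvar i - of_rat q *\<^sub>R 1) * (pvar i - of_rat q *\<^sub>R 1)) x
      = (\<Sum>(i, q)\<leftarrow>qs. (x i - of_rat q)\<^sup>2)"
    by (induction qs) (auto simp: peval_add peval_mult peval_diff peval_scaleR power2_eq_square)
  then show ?thesis by (simp add: ball_poly_def peval_diff peval_scaleR)
qed

text \<open>A common margin e around x is split in two: half for the radius of a rational ball, half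
  for the displacement of its centre from x.\<close>

lemma open_box_contains_ball_poly:
  assumes F: "finite F" and U: "\<And>i. i \<in> F \<Longrightarrow> open (U i)" "\<And>i. i \<in> F \<Longrightarrow> x i \<in> U i"
  obtains qs r where "fst ` set qs = F" "peval (ball_poly qs r) x < 0"
    "\<forall>y. peval (ball_poly qs r) y < 0 \<longrightarrow> (\<forall>i\<in>F. y i \<in> U i)"
proof -
  have "\<exists>e>0. \<forall>i\<in>F. ball (x i) e \<subseteq> U i"
    using F U
  proof (induction F rule: finite_induct)
    case empty
    then show ?case by (auto intro: exI[of _ 1])
  next
    case (insert j F)
    then obtain e where e: "e > 0" "\<forall>i\<in>F. ball (x i) e \<subseteq> U i" by auto
    obtain d where d: "d > 0" "ball (x j) d \<subseteq> U j"
      using insert.prems by (meson insertI1 openE)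
    show ?case
      using e d by (intro exI[of _ "min d e"]) (auto simp: subset_iff)
  qed
  then obtain e where e: "e > 0" "\<And>i. i \<in> F \<Longrightarrow> ball (x i) e \<subseteq> U i" by auto
  obtain r where r: "0 < real_of_rat r" "real_of_rat r < (e / 2)\<^sup>2"
    using of_rat_dense[of 0 "(e / 2)\<^sup>2"] e(1) by auto
  \<comment> \<open>With each centre coordinate within d of x, the squared distance is at most card
    F times d^2. The added 1 makes this strictly less than r and covers empty
    \<open>F\<close>.\<close>
  define d where "d = sqrt (of_rat r / (card F + 1))"
  have d: "d > 0" "d\<^sup>2 = of_rat r / (card F + 1)" using r(1) by (auto simp: d_def)
  have "\<forall>i. \<exists>q. \<bar>x i - of_rat q\<bar> < d"
  proof
    fix i
    obtain q where "x i - d < of_rat q" "of_rat q < x i + d"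
      using of_rat_dense[of "x i - d" "x i + d"] d(1) by auto
    then show "\<exists>q. \<bar>x i - of_rat q\<bar> < d" by (intro exI[of _ q]) linarith
  qed
  then obtain q where q: "\<And>i. \<bar>x i - of_rat (q i)\<bar> < d" by metis
  obtain xs where xs: "set xs = F" "distinct xs" using F finite_distinct_list by blast
  define qs where "qs = map (\<lambda>i. (i, q i)) xs"
  have ev: "peval (ball_poly qs r) y = (\<Sum>i\<in>F. (y i - of_rat (q i))\<^sup>2) - of_rat r" for y
    using xs by (simp add: peval_ball_poly qs_def comp_def sum_list_distinct_conv_sum_set)
  have sq: "(x i - of_rat (q i))\<^sup>2 \<le> d\<^sup>2" for i
    using q[of i] d(1) by (intro abs_le_square_iff[THEN iffD1]) simp
  show ?thesis
  proof
    show "fst ` set qs = F" using xs by (auto simp: qs_def image_image)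
    have "(\<Sum>i\<in>F. (x i - of_rat (q i))\<^sup>2) \<le> card F * d\<^sup>2"
      using sum_bounded_above[of F "\<lambda>i. (x i - of_rat (q i))\<^sup>2" "d\<^sup>2"] sq by simp
    also have "\<dots> < (card F + 1) * d\<^sup>2" using d(1) by simp
    also have "\<dots> = of_rat r" unfolding d(2) by simp
    finally show "peval (ball_poly qs r) x < 0" by (simp add: ev)
    show "\<forall>y. peval (ball_poly qs r) y < 0 \<longrightarrow> (\<forall>i\<in>F. y i \<in> U i)"
    proof (intro allI impI ballI)
      fix y i assume y: "peval (ball_poly qs r) y < 0" and i: "i \<in> F"
      have "(y i - of_rat (q i))\<^sup>2 \<le> (\<Sum>i\<in>F. (y i - of_rat (q i))\<^sup>2)"
        using F i by (intro member_le_sum) auto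
      then have "(y i - of_rat (q i))\<^sup>2 < (e / 2)\<^sup>2" using y r(2) by (simp add: ev)
      then have "\<bar>y i - of_rat (q i)\<bar> < e / 2" using e(1) by (metis abs_le_square_iff abs_of_pos half_gt_zero not_le)
      moreover have "d\<^sup>2 \<le> (e / 2)\<^sup>2"
      proof -
        have "d\<^sup>2 \<le> of_rat r" unfolding d(2) using r(1) by (simp add: field_simps)
        then show ?thesis using r(2) by linarith
      qed
      then have "d \<le> e / 2" by (rule power2_le_imp_le) (use e(1) in simp)
      ultimately have "dist (x i) (y i) < e" using q[of i] unfolding dist_real_def by linarith
      then show "y i \<in> U i" using e(2)[OF i] by auto
    qed
  qed
qed

text \<open>A point outside \<open>Y\<close> has its restriction in a basic box missing
  \<open>Y'\<close>. A rational ball inside this box and containing the point gives a polynomial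
  that is negative there and nonnegative on \<open>Y\<close>, so all such ball polynomials together
  cut out \<open>Y\<close>.\<close>

lemma cylinder_imp_countably_presented:
  assumes "countable_cylinder \<Omega> Y"
  shows "countably_presented \<Omega> Y"
proof -
  obtain I Y' where I: "I \<subseteq> \<Omega>" "countable I" and Y': "closedin (real_power I) Y'"
    and Y: "Y = {\<alpha> \<in> topspace (real_power \<Omega>). restrict \<alpha> I \<in> Y'}"
    using assms by (auto simp: countable_cylinder_def)
  define P where "P = (\<lambda>(qs, r). ball_poly qs r) ` (lists (I \<times> UNIV) \<times> UNIV)"
  define S where "S = {g \<in> P. \<forall>\<alpha>\<in>Y. 0 \<le> peval g \<alpha>}"
  have "countable P"
    unfolding P_def using I(2) by (intro countable_image countable_SIGMA countable_lists) auto
  then have "countable S" unfolding S_def by (rule countable_subset[rotated]) auto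
  moreover have "S \<subseteq> poly_alg \<Omega>"
    using I(1) by (force simp: S_def P_def intro!: ball_poly_in_poly_alg)
  moreover have "Y = {\<alpha> \<in> topspace (real_power \<Omega>). \<forall>g\<in>S. 0 \<le> peval g \<alpha>}"
  proof (intro equalityI subsetI)
    fix \<alpha> assume "\<alpha> \<in> Y"
    then show "\<alpha> \<in> {\<alpha> \<in> topspace (real_power \<Omega>). \<forall>g\<in>S. 0 \<le> peval g \<alpha>}"
      by (auto simp: S_def Y)
  next
    fix \<alpha> assume \<alpha>: "\<alpha> \<in> {\<alpha> \<in> topspace (real_power \<Omega>). \<forall>g\<in>S. 0 \<le> peval g \<alpha>}"
    show "\<alpha> \<in> Y"
    proof (rule ccontr)
      assume "\<alpha> \<notin> Y"
      then have "restrict \<alpha> I \<in> topspace (real_power I) - Y'" using \<alpha> by (auto simp: Y)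
      moreover have "openin (real_power I) (topspace (real_power I) - Y')"
        using Y' by (simp add: closedin_def)
      ultimately have "\<exists>U. finite {i \<in> I. U i \<noteq> topspace euclideanreal} \<and>
        (\<forall>i\<in>I. openin euclideanreal (U i)) \<and> restrict \<alpha> I \<in> Pi\<^sub>E I U \<and>
        Pi\<^sub>E I U \<subseteq> topspace (real_power I) - Y'"
        unfolding openin_product_topology_alt by (elim bspec[rotated])
      then obtain U where U: "finite {i \<in> I. U i \<noteq> topspace euclideanreal}"
        "\<And>i. i \<in> I \<Longrightarrow> openin euclideanreal (U i)" "restrict \<alpha> I \<in> Pi\<^sub>E I U"
        "Pi\<^sub>E I U \<subseteq> topspace (real_power I) - Y'"
        by auto
      define F where "F = {i \<in> I. U i \<noteq> UNIV}"
      have F: "finite F" using U(1) by (simp add: F_def)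
      have UF: "open (U i)" "\<alpha> i \<in> U i" if "i \<in> F" for i
        using that U(2)[of i] U(3) by (auto simp: F_def PiE_iff split: if_splits)
      obtain qs r where qs: "fst ` set qs = F" "peval (ball_poly qs r) \<alpha> < 0"
        "\<forall>y. peval (ball_poly qs r) y < 0 \<longrightarrow> (\<forall>i\<in>F. y i \<in> U i)"
        by (rule open_box_contains_ball_poly[OF F UF])
      have "set qs \<subseteq> I \<times> UNIV" using qs(1) by (force simp: F_def)
      then have "ball_poly qs r \<in> P" by (auto simp: P_def lists_eq_set)
      moreover have "0 \<le> peval (ball_poly qs r) y" if y: "y \<in> Y" for y
      proof (rule ccontr)
        assume "\<not> 0 \<le> peval (ball_poly qs r) y"
        then have "y i \<in> U i" if "i \<in> I" for i
          using qs(3) that by (cases "i \<in> F") (auto simp: F_def)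
        then have "restrict y I \<in> Pi\<^sub>E I U" by auto
        then have "restrict y I \<notin> Y'" using U(4) by blast
        then show False using y by (simp add: Y)
      qed
      ultimately have "ball_poly qs r \<in> S" by (simp add: S_def)
      then show False using \<alpha> qs(2) by auto
    qed
  qed
  ultimately show ?thesis unfolding countably_presented_def by blast
qed

section \<open>Representing measures\<close>

lemma point_eval_in_char_space: "point_eval \<Omega> x \<in> char_space (poly_alg \<Omega>)"
  by (simp add: char_space_def point_eval_def peval_add peval_mult
      one_in_poly_alg add_in_poly_alg mult_in_poly_alg)

definition power_algebra :: "'i set \<Rightarrow> ('i \<Rightarrow> real) measure" where
  "power_algebra \<Omega> = vimage_algebra (topspace (real_power \<Omega>)) (point_eval \<Omega>) (constr_borel (poly_alg \<Omega>))"

lemma space_power_algebra: "space (power_algebra \<Omega>) = topspace (real_power \<Omega>)"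
  by (simp add: power_algebra_def)

lemma point_eval_measurable: "point_eval \<Omega> \<in> measurable (power_algebra \<Omega>) (constr_borel (poly_alg \<Omega>))"
  unfolding power_algebra_def
  by (rule measurable_vimage_algebra1) (simp add: space_constr_borel point_eval_in_char_space)

lemma peval_measurable_power_algebra:
  assumes f: "f \<in> poly_alg \<Omega>"
  shows "peval f \<in> borel_measurable (power_algebra \<Omega>)"
  unfolding borel_measurable_iff_greater
proof
  fix r :: real
  let ?g = "f - r *\<^sub>R 1"
  have g: "?g \<in> poly_alg \<Omega>"
    using f by (intro diff_in_poly_alg scaleR_in_poly_alg one_in_poly_alg)
  have "{\<alpha> \<in> char_space (poly_alg \<Omega>). \<alpha> ?g > 0} \<in> sets (constr_borel (poly_alg \<Omega>))"
    unfolding constr_borel_def using g by (intro in_measure_of) auto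
  then have "point_eval \<Omega> -` {\<alpha> \<in> char_space (poly_alg \<Omega>). \<alpha> ?g > 0} \<inter> space (power_algebra \<Omega>)
      \<in> sets (power_algebra \<Omega>)"
    by (rule measurable_sets[OF point_eval_measurable])
  also have "point_eval \<Omega> -` {\<alpha> \<in> char_space (poly_alg \<Omega>). \<alpha> ?g > 0} \<inter> space (power_algebra \<Omega>)
      = {x \<in> space (power_algebra \<Omega>). r < peval f x}"
    using g point_eval_in_char_space[of \<Omega>]
    by (auto simp: point_eval_def peval_diff peval_scaleR)
  finally show "{x \<in> space (power_algebra \<Omega>). r < peval f x} \<in> sets (power_algebra \<Omega>)" .
qed

text \<open>The target sigma-algebra is pulled back from one generated by strict positivity of
  evaluations, so only compositions with polynomials need testing.\<close>

lemma measurable_into_power_algebra: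
  assumes X: "\<And>b. b \<in> space M \<Longrightarrow> X b \<in> topspace (real_power \<Omega>)"
    and meas: "\<And>f. f \<in> poly_alg \<Omega> \<Longrightarrow> (\<lambda>b. peval f (X b)) \<in> borel_measurable M"
  shows "X \<in> measurable M (power_algebra \<Omega>)"
  unfolding power_algebra_def
proof (rule measurable_vimage_algebra2)
  show "X \<in> space M \<rightarrow> topspace (real_power \<Omega>)" using X by auto
  show "(\<lambda>b. point_eval \<Omega> (X b)) \<in> measurable M (constr_borel (poly_alg \<Omega>))"
    unfolding constr_borel_def
  proof (rule measurable_measure_of)
    fix A assume "A \<in> {{\<alpha> \<in> char_space (poly_alg \<Omega>). \<alpha> a > 0} |a. a \<in> poly_alg \<Omega>}"
    then obtain f where f: "f \<in> poly_alg \<Omega>" "A = {\<alpha> \<in> char_space (poly_alg \<Omega>). \<alpha> f > 0}" by auto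
    have "(\<lambda>b. point_eval \<Omega> (X b)) -` A \<inter> space M = {b \<in> space M. 0 < peval f (X b)}"
      using f point_eval_in_char_space[of \<Omega>] by (auto simp: point_eval_def)
    also have "\<dots> \<in> sets M"
      using meas[OF f(1)] by (simp add: borel_measurable_iff_greater)
    finally show "(\<lambda>b. point_eval \<Omega> (X b)) -` A \<inter> space M \<in> sets M" .
  qed (auto simp: point_eval_in_char_space)
qed

lemma finite_measure_constr_radon_power:
  assumes sets: "sets \<nu> = sets (power_algebra \<Omega>)" and fin: "finite_measure \<nu>"
    and int: "\<And>f. f \<in> poly_alg \<Omega> \<Longrightarrow> integrable \<nu> (peval f)"
  shows "constr_radon_power \<Omega> \<nu>"
  unfolding constr_radon_power_def
proof (intro conjI allI impI)
  show "space \<nu> = topspace (real_power \<Omega>)"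
    using sets_eq_imp_space_eq[OF sets] by (simp add: space_power_algebra)
  show "sets \<nu> = sets (vimage_algebra (topspace (real_power \<Omega>)) (point_eval \<Omega>) (constr_borel (poly_alg \<Omega>)))"
    using sets by (simp add: power_algebra_def)
  have "point_eval \<Omega> \<in> measurable \<nu> (constr_borel (poly_alg \<Omega>))"
    using point_eval_measurable by (subst measurable_cong_sets[OF sets refl])
  then have "finite_measure (distr \<nu> (constr_borel (poly_alg \<Omega>)) (point_eval \<Omega>))"
    by (rule finite_measure.finite_measure_distr[OF fin])
  then show "constr_radon (poly_alg \<Omega>) (distr \<nu> (constr_borel (poly_alg \<Omega>)) (point_eval \<Omega>))"
    by (intro finite_measure_constr_radon) simp_all
  show "integrable \<nu> (peval (Poly_Mapping.single m 1))" if "Poly_Mapping.keys m \<subseteq> \<Omega>" for m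
    using that by (intro int single_in_poly_alg)
qed

lemma (in digit_measure) representing_measure:
  assumes S: "S \<subseteq> poly_alg \<Omega>" "countable S"
    and Y: "Y = {\<alpha> \<in> topspace (real_power \<Omega>). \<forall>g\<in>S. 0 \<le> peval g \<alpha>}"
  shows "\<exists>\<nu>. constr_radon_power \<Omega> \<nu> \<and> supported_by \<nu> Y \<and>
    (\<forall>f\<in>poly_alg \<Omega>. \<Lambda> (peval f) = integral\<^sup>L \<nu> (peval f))"
proof -
  \<comment> \<open>Coordinates outside \<open>\<Omega>\<close> have no moment control; restricting
    discards them and yields an extensional point.\<close>
  define X where "X = (\<lambda>b. restrict (realize b) \<Omega>)"
  have peval_X: "peval f (X b) = peval f (realize b)" if "f \<in> poly_alg \<Omega>" for f b
    using that by (rule peval_cong) (simp add: X_def)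
  have X [measurable]: "X \<in> measurable \<mu> (power_algebra \<Omega>)"
    by (rule measurable_into_power_algebra) (auto simp: X_def peval_X[unfolded X_def])
  define \<nu> where "\<nu> = distr \<mu> (power_algebra \<Omega>) X"
  have int: "integrable \<nu> (peval f)" "integral\<^sup>L \<nu> (peval f) = \<Lambda> (peval f)" if f: "f \<in> poly_alg \<Omega>" for f
    using peval_integral[OF f] peval_measurable_power_algebra[OF f] X
    unfolding \<nu>_def by (simp_all add: integrable_distr_eq integral_distr peval_X[OF f])
  have "constr_radon_power \<Omega> \<nu>"
    by (rule finite_measure_constr_radon_power) (auto simp: \<nu>_def intro: finite_measure_distr X int[unfolded \<nu>_def])
  moreover have "supported_by \<nu> Y"
    unfolding supported_by_def
  proof (intro ballI impI)
    fix E assume E: "E \<in> sets \<nu>" "E \<inter> Y = {}"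
    \<comment> \<open>Countability of \<open>S\<close> is spent here, on uniting the exceptional
      null sets.\<close>
    have "AE b in \<mu>. \<forall>g\<in>S. 0 \<le> peval g (realize b)"
      using S Y by (subst AE_ball_countable) (auto intro!: AE_peval_nonneg)
    then have "AE b in \<mu>. X b \<notin> E"
    proof eventually_elim
      case (elim b)
      have "X b \<in> topspace (real_power \<Omega>)" by (simp add: X_def)
      moreover have "0 \<le> peval g (X b)" if "g \<in> S" for g
        using elim S(1) that by (auto simp: peval_X subset_iff)
      ultimately have "X b \<in> Y" by (simp add: Y)
      then show ?case using E(2) by auto
    qed
    then have "emeasure \<mu> {b \<in> space \<mu>. X b \<in> E} = 0"
      by (intro emeasure_eq_0_AE)
    moreover have "emeasure \<nu> E = emeasure \<mu> {b \<in> space \<mu>. X b \<in> E}"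
      using E(1) X by (simp add: \<nu>_def emeasure_distr vimage_def Int_def conj_commute)
    ultimately show "emeasure \<nu> E = 0" by simp
  qed
  ultimately show ?thesis using int(2) by (intro exI[of _ \<nu>]) simp
qed

theorem proposition5p1:
  fixes \<Omega> :: "'i set"
    and L :: "'i mpolynomial \<Rightarrow> real"
    and Y :: "('i \<Rightarrow> real) set"
  assumes "\<And>f g. f \<in> poly_alg \<Omega> \<Longrightarrow> g \<in> poly_alg \<Omega> \<Longrightarrow> L (f + g) = L f + L g"
    and "\<And>c f. f \<in> poly_alg \<Omega> \<Longrightarrow> L (c *\<^sub>R f) = c * L f"
    and "L ` Pos \<Omega> Y \<subseteq> {0..}"
    and "closedin (real_power \<Omega>) Y"
  shows "(countably_presented \<Omega> Y \<longleftrightarrow> countable_cylinder \<Omega> Y) \<and>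
    (countably_presented \<Omega> Y \<or> countable_cylinder \<Omega> Y \<longrightarrow>
      (\<exists>\<nu>. constr_radon_power \<Omega> \<nu> \<and> supported_by \<nu> Y \<and>
        (\<forall>f\<in>poly_alg \<Omega>. L f = integral\<^sup>L \<nu> (peval f))))"
proof -
  \<comment> \<open>A cylinder is traded for a countable presentation, the form in which the almost
    everywhere argument uses \<open>Y\<close>.\<close>
  have equiv: "countably_presented \<Omega> Y \<longleftrightarrow> countable_cylinder \<Omega> Y"
    using countably_presented_imp_cylinder cylinder_imp_countably_presented by blast
  moreover have "\<exists>\<nu>. constr_radon_power \<Omega> \<nu> \<and> supported_by \<nu> Y \<and>
      (\<forall>f\<in>poly_alg \<Omega>. L f = integral\<^sup>L \<nu> (peval f))" if Y: "countably_presented \<Omega> Y"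
  proof -
    obtain S where S: "S \<subseteq> poly_alg \<Omega>" "countable S"
      "Y = {\<alpha> \<in> topspace (real_power \<Omega>). \<forall>g\<in>S. 0 \<le> peval g \<alpha>}"
      using Y by (auto simp: countably_presented_def)
    obtain \<Lambda> where \<Lambda>: "positive_functional \<Omega> Y \<Lambda>" "\<And>f. f \<in> poly_alg \<Omega> \<Longrightarrow> \<Lambda> (peval f) = L f"
      using extend_positive_functional[OF assms(1-3)] by metis
    obtain \<mu> where "digit_measure \<Omega> Y \<Lambda> \<mu>"
      using positive_functional.digit_measure_exists[OF \<Lambda>(1)] by blast
    from digit_measure.representing_measure[OF this S] show ?thesis
      using \<Lambda>(2) by simp
  qed
  ultimately show ?thesis by blast
qed

end
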